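(* Let $\mathcal G$ be a connected groupoid, $x\in\mathcal G_0$, $\tau(x)=\{\tau_y\}_{y\in\mathcal G_0}$ a transversal for $x$ and $A$ a ring. Let $F_{\tau(x)}:\mathcal G_{par}(A)\to\mathcal D_{\tau(x)}(A)$ and $G_{\tau(x)}:\mathcal D_{\tau(x)}(A)\to\mathcal G_{par}(A)$ be the functors defined in the context. (i) If $\alpha=(A_g,\alpha_g)_{g\in\mathcal G}\in\mathcal G_{par}(A)$ and $\beta=G_{\tau(x)}\circ F_{\tau(x)}(\alpha)$, then $\beta\le\alpha$, that is, $\beta_g\le\alpha_g$ for all $g\in\mathcal G$. Moreover, $\beta=\alpha$ if and only if $A_g\subseteq A_{\tau_{t(g)}}\cap A_{g\tau_{s(g)}}$ for all $g\notin\mathcal G_0$. (ii) $F_{\tau(x)}$ is a left inverse functor of $G_{\tau(x)}$, that is, $F_{\tau(x)}\circ G_{\tau(x)}(\gamma)=\gamma$ for all $\gamma\in\mathcal D_{\tau(x)}(A)$.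
   Context: Conventions. Rings are associative, not necessarily unital; ideals are two-sided. A groupoid $\mathcal G$ is a small category in which every morphism is invertible; it is identified with its set of morphisms, and its set of objects $\mathcal G_0$ is identified with the set of identity morphisms. For $g\in\mathcal G$, $s(g)=g^{-1}g$ and $t(g)=gg^{-1}$; $gh$ is defined iff $s(g)=t(h)$. Put $\mathcal G(y,z)=\{g: s(g)=y,\ t(g)=z\}$ and $\mathcal G(x)=\mathcal G(x,x)$ (a group). $\mathcal G$ is connected if $\mathcal G(y,z)\neq\emptyset$ for all $y,z\in\mathcal G_0$. A transversal for $x$ is a family $\tau(x)=\{\tau_y: y\in\mathcal G_0\}$ with $\tau_y\in\mathcal G(x,y)$ and $\tau_x=x$. Put $g_x=\tau_{t(g)}^{-1}g\tau_{s(g)}\in\mathcal G(x)$. For partial bijections $u,v$ of a set, $u\circ v$ has domain $v^{-1}(\mathrm{dom}(u)\cap\mathrm{ran}(v))$ and range $u(\mathrm{dom}(u)\cap\mathrm{ran}(v))$; $u\le v$ means that $\mathrm{dom}(u)\subseteq\mathrm{dom}(v)$ and $v$ agrees with $u$ on $\mathrm{dom}(u)$. A partial action of a groupoid $\mathcal G$ on $A$ is a family $\alpha=(A_g,\alpha_g)_{g\in\mathcal G}$ where, for each $g$, $A_{t(g)}$ is an ideal of $A$, $A_g$ is an ideal of $A_{t(g)}$, $\alpha_g:A_{g^{-1}}\to A_g$ is a ring isomorphism, $\alpha_y=\mathrm{id}_{A_y}$ for $y\in\mathcal G_0$, and $\alpha_g\alpha_h\le\alpha_{gh}$ whenever $s(g)=t(h)$.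 A partial action of a group $H$ on a ring $R$ is the one-object case with the ideal attached to the identity equal to $R$. $\mathcal G_{par}(A)$ is the category whose objects are the partial actions of $\mathcal G$ on $A$; a morphism $\alpha\to\alpha'$ is a family of ring homomorphisms $\psi=\{\psi_y:A_y\to A'_y\}_{y\in\mathcal G_0}$ with $\psi_{t(g)}(A_g)\subseteq A'_g$ and $\alpha'_g\psi_{s(g)}=\psi_{t(g)}\alpha_g$ on $A_{g^{-1}}$ for all $g\in\mathcal G$. $\mathcal D_{\tau(x)}(A)$: objects are data $(I,\gamma_{\tau(x)},\gamma_{(x)})$ consisting of (a) a family $I=\{I_y\}_{y\in\mathcal G_0}$ of ideals of $A$; (b) ring isomorphisms $\gamma_{\tau(x)}=\{\gamma_{\tau_y}:I_{\tau_y^{-1}}\to I_{\tau_y}\}_{y\in\mathcal G_0}$; (c) a partial action $\gamma_{(x)}=(I_h,\gamma_h)_{h\in\mathcal G(x)}$ of the group $\mathcal G(x)$ on $I_x$; such that (d) $\gamma_x=\gamma_{\tau_x}$ is the identity map of $I_x=I_{\tau_x}$; (e) $I_{\tau_y}$ is an ideal of $I_y$ and $I_{\tau_y^{-1}}$ is an ideal of $I_x$ for all $y$; (f) $\gamma_{\tau_{t(g)}}\big(I_{\tau_{t(g)}^{-1}}\cap\gamma_{g_x}(I_{\tau_{s(g)}^{-1}}\cap I_{g_x^{-1}})\big)$ is an ideal of $I_{t(g)}$ for all $g\in\mathcal G$. A morphism to $(I',\gamma'_{\tau(x)},\gamma'_{(x)})$ is a family of ring homomorphisms $\{f_y:I_y\to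 I'_y\}_{y\in\mathcal G_0}$ such that $f_y(I_{\tau_y})\subseteq I'_{\tau_y}$ ($y\neq x$), $f_x(I_{\tau_y^{-1}})\subseteq I'_{\tau_y^{-1}}$, $\gamma'_{\tau_y}f_x=f_y\gamma_{\tau_y}$ on $I_{\tau_y^{-1}}$ for all $y$, and $f_x(I_h)\subseteq I'_h$, $\gamma'_hf_x=f_x\gamma_h$ on $I_{h^{-1}}$ for all $h\in\mathcal G(x)$. The functor $F_{\tau(x)}$ sends $\alpha=(A_g,\alpha_g)_{g\in\mathcal G}$ to $(\{A_y\}_{y\in\mathcal G_0},\{\alpha_{\tau_y}:A_{\tau_y^{-1}}\to A_{\tau_y}\}_{y\in\mathcal G_0},(A_h,\alpha_h)_{h\in\mathcal G(x)})$ and a morphism $\psi$ to $\{\psi_y\}_{y\in\mathcal G_0}$. The functor $G_{\tau(x)}$ sends $(I,\gamma_{\tau(x)},\gamma_{(x)})$ to $\beta=(B_g,\beta_g)_{g\in\mathcal G}$, where $\beta_y=\mathrm{id}_{I_y}$ for $y\in\mathcal G_0$, $\beta_g=\gamma_{\tau_{t(g)}}\circ\gamma_{g_x}\circ\gamma_{\tau_{s(g)}}^{-1}$ (composition of partial bijections) for $g\notin\mathcal G_0$, and $B_g$ is the range of $\beta_g$; it sends a morphism $\{f_y\}_{y\in\mathcal G_0}$ to $\{f_y\}_{y\in\mathcal G_0}$. (These are functors; in particular $\beta$ is a partial action of $\mathcal G$ on $A$.) *)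

theory Defs
  imports "HOL-Library.FuncSet"
begin

section \<open>Partial bijections\<close>

text \<open>
  A partial map of a set is a map \<open>m :: 'a \<rightharpoonup> 'a\<close> of the library.  The composition \<open>u \<circ>\<^sub>m v\<close> is
  the composition of partial maps on the largest possible domain, and \<open>u \<subseteq>\<^sub>m v\<close> says that
  \<open>v\<close> extends \<open>u\<close>.  The image of a set \<open>S\<close> under \<open>m\<close> is \<open>ran (m |` S)\<close>.
\<close>

definition pid :: "'a set \<Rightarrow> 'a \<rightharpoonup> 'a" where
  "pid S = Some |` S"

definition pinv :: "('a \<rightharpoonup> 'b) \<Rightarrow> 'b \<rightharpoonup> 'a" where
  "pinv m = (\<lambda>b. if b \<in> ran m then Some (THE a. m a = Some b) else None)"

section \<open>Rings and ideals\<close>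

text \<open>
  The class \<^class>\<open>ring\<close> consists of the associative, not necessarily unital rings.  Ideals of
  ideals occur, so the ambient ring \<open>R\<close> is a subset of the type.
\<close>

definition ideal_of :: "'a::ring set \<Rightarrow> 'a set \<Rightarrow> bool" where
  "ideal_of I R \<longleftrightarrow> I \<subseteq> R \<and> 0 \<in> I \<and> (\<forall>a\<in>I. \<forall>b\<in>I. a + b \<in> I) \<and> (\<forall>a\<in>I. - a \<in> I) \<and>
     (\<forall>r\<in>R. \<forall>a\<in>I. r * a \<in> I \<and> a * r \<in> I)"

definition ring_homom :: "('a::ring \<rightharpoonup> 'a) \<Rightarrow> 'a set \<Rightarrow> 'a set \<Rightarrow> bool" where
  "ring_homom m R S \<longleftrightarrow> dom m = R \<and> ran m \<subseteq> S \<and>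
     (\<forall>a\<in>R. \<forall>b\<in>R. the (m (a + b)) = the (m a) + the (m b) \<and>
                    the (m (a * b)) = the (m a) * the (m b))"

definition ring_isom :: "('a::ring \<rightharpoonup> 'a) \<Rightarrow> 'a set \<Rightarrow> 'a set \<Rightarrow> bool" where
  "ring_isom m R S \<longleftrightarrow> ring_homom m R S \<and> inj_on m R \<and> ran m = S"

section \<open>Groupoids\<close>

text \<open>
  Objects are identified with identity morphisms.  The product \<open>g \<cdot> h\<close> is meaningful only if
  \<open>src g = tgt h\<close>.
\<close>

record 'g groupoid_data =
  arr :: "'g set"
  src :: "'g \<Rightarrow> 'g"
  tgt :: "'g \<Rightarrow> 'g"
  mul :: "'g \<Rightarrow> 'g \<Rightarrow> 'g" (infixl "\<cdot>\<index>" 70)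

definition objs :: "'g groupoid_data \<Rightarrow> 'g set" where
  "objs \<G> = {y \<in> arr \<G>. src \<G> y = y \<and> tgt \<G> y = y}"

definition groupoid :: "'g groupoid_data \<Rightarrow> bool" where
  "groupoid \<G> \<longleftrightarrow>
     (\<forall>g\<in>arr \<G>. src \<G> g \<in> objs \<G> \<and> tgt \<G> g \<in> objs \<G>) \<and>
     (\<forall>g\<in>arr \<G>. \<forall>h\<in>arr \<G>. src \<G> g = tgt \<G> h \<longrightarrow>
        g \<cdot>\<^bsub>\<G>\<^esub> h \<in> arr \<G> \<and> src \<G> (g \<cdot>\<^bsub>\<G>\<^esub> h) = src \<G> h \<and> tgt \<G> (g \<cdot>\<^bsub>\<G>\<^esub> h) = tgt \<G> g) \<and>
     (\<forall>g\<in>arr \<G>. \<forall>h\<in>arr \<G>. \<forall>k\<in>arr \<G>. src \<G> g = tgt \<G> h \<longrightarrow> src \<G> h = tgt \<G> k \<longrightarrow>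
        (g \<cdot>\<^bsub>\<G>\<^esub> h) \<cdot>\<^bsub>\<G>\<^esub> k = g \<cdot>\<^bsub>\<G>\<^esub> (h \<cdot>\<^bsub>\<G>\<^esub> k)) \<and>
     (\<forall>g\<in>arr \<G>. g \<cdot>\<^bsub>\<G>\<^esub> src \<G> g = g \<and> tgt \<G> g \<cdot>\<^bsub>\<G>\<^esub> g = g) \<and>
     (\<forall>g\<in>arr \<G>. \<exists>h\<in>arr \<G>. src \<G> h = tgt \<G> g \<and> tgt \<G> h = src \<G> g \<and>
        h \<cdot>\<^bsub>\<G>\<^esub> g = src \<G> g \<and> g \<cdot>\<^bsub>\<G>\<^esub> h = tgt \<G> g)"

definition ginv :: "'g groupoid_data \<Rightarrow> 'g \<Rightarrow> 'g" where
  "ginv \<G> g = (THE h. h \<in> arr \<G> \<and> src \<G> h = tgt \<G> g \<and> tgt \<G> h = src \<G> g \<and>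
     h \<cdot>\<^bsub>\<G>\<^esub> g = src \<G> g \<and> g \<cdot>\<^bsub>\<G>\<^esub> h = tgt \<G> g)"

definition arrows_from_to :: "'g groupoid_data \<Rightarrow> 'g \<Rightarrow> 'g \<Rightarrow> 'g set" where
  "arrows_from_to \<G> y z = {g \<in> arr \<G>. src \<G> g = y \<and> tgt \<G> g = z}"

definition connected_groupoid :: "'g groupoid_data \<Rightarrow> bool" where
  "connected_groupoid \<G> \<longleftrightarrow> (\<forall>y\<in>objs \<G>. \<forall>z\<in>objs \<G>. arrows_from_to \<G> y z \<noteq> {})"

text \<open>The group of arrows from \<open>x\<close> to \<open>x\<close>, as a groupoid whose only object is \<open>x\<close>.\<close>

definition isotropy :: "'g groupoid_data \<Rightarrow> 'g \<Rightarrow> 'g groupoid_data" where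
  "isotropy \<G> x = \<G>\<lparr>arr := arrows_from_to \<G> x x\<rparr>"

definition transversal :: "'g groupoid_data \<Rightarrow> 'g \<Rightarrow> ('g \<Rightarrow> 'g) \<Rightarrow> bool" where
  "transversal \<G> x \<tau> \<longleftrightarrow> (\<forall>y\<in>objs \<G>. \<tau> y \<in> arrows_from_to \<G> x y) \<and> \<tau> x = x"

text \<open>The arrow \<open>g\<^sub>x\<close>.\<close>

definition loop_of :: "'g groupoid_data \<Rightarrow> ('g \<Rightarrow> 'g) \<Rightarrow> 'g \<Rightarrow> 'g" where
  "loop_of \<G> \<tau> g = ginv \<G> (\<tau> (tgt \<G> g)) \<cdot>\<^bsub>\<G>\<^esub> g \<cdot>\<^bsub>\<G>\<^esub> \<tau> (src \<G> g)"

section \<open>Partial actions\<close>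

text \<open>
  Families indexed by a set of arrows or objects are total functions that are \<^const>\<open>undefined\<close>
  outside the index set, so that equality of families is equality in the logic.
\<close>

record ('g, 'a) paction =
  pset :: "'g \<Rightarrow> 'a set"
  pmap :: "'g \<Rightarrow> 'a \<rightharpoonup> 'a"

text \<open>Partial actions of \<open>\<G>\<close> on the ring with underlying set \<open>R\<close>.\<close>

definition partial_action :: "'g groupoid_data \<Rightarrow> 'a::ring set \<Rightarrow> ('g, 'a) paction \<Rightarrow> bool" where
  "partial_action \<G> R \<alpha> \<longleftrightarrow>
     pset \<alpha> \<in> extensional (arr \<G>) \<and> pmap \<alpha> \<in> extensional (arr \<G>) \<and>
     (\<forall>g\<in>arr \<G>. ideal_of (pset \<alpha> (tgt \<G> g)) R \<and>
        ideal_of (pset \<alpha> g) (pset \<alpha> (tgt \<G> g)) \<and>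
        ring_isom (pmap \<alpha> g) (pset \<alpha> (ginv \<G> g)) (pset \<alpha> g)) \<and>
     (\<forall>y\<in>objs \<G>. pmap \<alpha> y = pid (pset \<alpha> y)) \<and>
     (\<forall>g\<in>arr \<G>. \<forall>h\<in>arr \<G>. src \<G> g = tgt \<G> h \<longrightarrow>
        pmap \<alpha> g \<circ>\<^sub>m pmap \<alpha> h \<subseteq>\<^sub>m pmap \<alpha> (g \<cdot>\<^bsub>\<G>\<^esub> h))"

definition partial_group_action ::
    "'g groupoid_data \<Rightarrow> 'g \<Rightarrow> 'a::ring set \<Rightarrow> ('g, 'a) paction \<Rightarrow> bool" where
  "partial_group_action \<G> x R \<alpha> \<longleftrightarrow> partial_action (isotropy \<G> x) R \<alpha> \<and> pset \<alpha> x = R"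

section \<open>Categories and functors\<close>

record ('o, 'm) cat =
  Ob :: "'o set"
  Hom :: "'o \<Rightarrow> 'o \<Rightarrow> 'm set"
  Ident :: "'o \<Rightarrow> 'm"
  Comp :: "'m \<Rightarrow> 'm \<Rightarrow> 'm"

definition is_category :: "('o, 'm) cat \<Rightarrow> bool" where
  "is_category C \<longleftrightarrow>
     (\<forall>a\<in>Ob C. Ident C a \<in> Hom C a a) \<and>
     (\<forall>a\<in>Ob C. \<forall>b\<in>Ob C. \<forall>c\<in>Ob C. \<forall>f\<in>Hom C a b. \<forall>g\<in>Hom C b c. Comp C g f \<in> Hom C a c) \<and>
     (\<forall>a\<in>Ob C. \<forall>b\<in>Ob C. \<forall>f\<in>Hom C a b. Comp C f (Ident C a) = f \<and> Comp C (Ident C b) f = f) \<and>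
     (\<forall>a\<in>Ob C. \<forall>b\<in>Ob C. \<forall>c\<in>Ob C. \<forall>d\<in>Ob C. \<forall>f\<in>Hom C a b. \<forall>g\<in>Hom C b c. \<forall>h\<in>Hom C c d.
        Comp C h (Comp C g f) = Comp C (Comp C h g) f)"

record ('o, 'm, 'p, 'n) functor_data =
  fob :: "'o \<Rightarrow> 'p"
  fmor :: "'m \<Rightarrow> 'n"

definition is_functor :: "('o, 'm) cat \<Rightarrow> ('p, 'n) cat \<Rightarrow> ('o, 'm, 'p, 'n) functor_data \<Rightarrow> bool" where
  "is_functor C D F \<longleftrightarrow>
     (\<forall>a\<in>Ob C. fob F a \<in> Ob D \<and> fmor F (Ident C a) = Ident D (fob F a)) \<and>
     (\<forall>a\<in>Ob C. \<forall>b\<in>Ob C. \<forall>f\<in>Hom C a b. fmor F f \<in> Hom D (fob F a) (fob F b)) \<and>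
     (\<forall>a\<in>Ob C. \<forall>b\<in>Ob C. \<forall>c\<in>Ob C. \<forall>f\<in>Hom C a b. \<forall>g\<in>Hom C b c.
        fmor F (Comp C g f) = Comp D (fmor F g) (fmor F f))"

definition functor_comp ::
    "('p, 'n, 'q, 'k) functor_data \<Rightarrow> ('o, 'm, 'p, 'n) functor_data \<Rightarrow> ('o, 'm, 'q, 'k) functor_data"
    (infixl "\<circ>\<^sub>F" 55) where
  "F \<circ>\<^sub>F G = \<lparr>fob = fob F \<circ> fob G, fmor = fmor F \<circ> fmor G\<rparr>"

section \<open>The category of partial actions\<close>

type_synonym ('g, 'a) family = "'g \<Rightarrow> 'a \<rightharpoonup> 'a"

definition family_comp :: "'g set \<Rightarrow> ('g, 'a) family \<Rightarrow> ('g, 'a) family \<Rightarrow> ('g, 'a) family" where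
  "family_comp Y \<psi>' \<psi> = (\<lambda>y\<in>Y. \<psi>' y \<circ>\<^sub>m \<psi> y)"

definition par_morphism ::
    "'g groupoid_data \<Rightarrow> ('g, 'a::ring) paction \<Rightarrow> ('g, 'a) paction \<Rightarrow> ('g, 'a) family \<Rightarrow> bool" where
  "par_morphism \<G> \<alpha> \<alpha>' \<psi> \<longleftrightarrow>
     \<psi> \<in> extensional (objs \<G>) \<and>
     (\<forall>y\<in>objs \<G>. ring_homom (\<psi> y) (pset \<alpha> y) (pset \<alpha>' y)) \<and>
     (\<forall>g\<in>arr \<G>. ran (\<psi> (tgt \<G> g) |` pset \<alpha> g) \<subseteq> pset \<alpha>' g \<and>
        (\<forall>a\<in>pset \<alpha> (ginv \<G> g).
           (pmap \<alpha>' g \<circ>\<^sub>m \<psi> (src \<G> g)) a = (\<psi> (tgt \<G> g) \<circ>\<^sub>m pmap \<alpha> g) a))"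

text \<open>The ring \<open>A\<close> is the type \<open>'a\<close>.\<close>

definition Gpar :: "'g groupoid_data \<Rightarrow> (('g, 'a::ring) paction, ('g, 'a) family) cat" where
  "Gpar \<G> = \<lparr>
     Ob = {\<alpha>. partial_action \<G> UNIV \<alpha>},
     Hom = (\<lambda>\<alpha> \<alpha>'. {\<psi>. par_morphism \<G> \<alpha> \<alpha>' \<psi>}),
     Ident = (\<lambda>\<alpha>. \<lambda>y\<in>objs \<G>. pid (pset \<alpha> y)),
     Comp = family_comp (objs \<G>)\<rparr>"

section \<open>The category of transversal data\<close>

text \<open>
  An object consists of the ideals \<open>I\<^sub>y\<close>, the isomorphisms attached to the arrows \<open>\<tau> y\<close> and a partial
  action of the isotropy group.  The isomorphisms are indexed by the objects \<open>y\<close>, and as partial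
  maps they determine the ideals attached to \<open>\<tau> y\<close> and to its inverse: these are \<open>ran (tmap \<gamma> y)\<close>
  and \<open>dom (tmap \<gamma> y)\<close>, respectively.
\<close>

record ('g, 'a) tdata =
  tset :: "'g \<Rightarrow> 'a set"
  tmap :: "'g \<Rightarrow> 'a \<rightharpoonup> 'a"
  tact :: "('g, 'a) paction"

definition transversal_data ::
    "'g groupoid_data \<Rightarrow> 'g \<Rightarrow> ('g \<Rightarrow> 'g) \<Rightarrow> ('g, 'a::ring) tdata \<Rightarrow> bool" where
  "transversal_data \<G> x \<tau> \<gamma> \<longleftrightarrow>
     tset \<gamma> \<in> extensional (objs \<G>) \<and> (\<forall>y\<in>objs \<G>. ideal_of (tset \<gamma> y) UNIV) \<and>
     tmap \<gamma> \<in> extensional (objs \<G>) \<and>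
     (\<forall>y\<in>objs \<G>. ring_isom (tmap \<gamma> y) (dom (tmap \<gamma> y)) (ran (tmap \<gamma> y))) \<and>
     partial_group_action \<G> x (tset \<gamma> x) (tact \<gamma>) \<and>
     pmap (tact \<gamma>) x = pid (tset \<gamma> x) \<and> tmap \<gamma> x = pid (tset \<gamma> x) \<and>
     (\<forall>y\<in>objs \<G>. ideal_of (ran (tmap \<gamma> y)) (tset \<gamma> y) \<and> ideal_of (dom (tmap \<gamma> y)) (tset \<gamma> x)) \<and>
     (\<forall>g\<in>arr \<G>.
        ideal_of
          (ran (tmap \<gamma> (tgt \<G> g) |`
             (dom (tmap \<gamma> (tgt \<G> g)) \<inter>
              ran (pmap (tact \<gamma>) (loop_of \<G> \<tau> g) |`
                (dom (tmap \<gamma> (src \<G> g)) \<inter> pset (tact \<gamma>) (ginv \<G> (loop_of \<G> \<tau> g)))))))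
          (tset \<gamma> (tgt \<G> g)))"

definition tdata_morphism ::
    "'g groupoid_data \<Rightarrow> 'g \<Rightarrow> ('g, 'a::ring) tdata \<Rightarrow> ('g, 'a) tdata \<Rightarrow> ('g, 'a) family \<Rightarrow> bool" where
  "tdata_morphism \<G> x \<gamma> \<gamma>' f \<longleftrightarrow>
     f \<in> extensional (objs \<G>) \<and>
     (\<forall>y\<in>objs \<G>. ring_homom (f y) (tset \<gamma> y) (tset \<gamma>' y)) \<and>
     (\<forall>y\<in>objs \<G>. (y \<noteq> x \<longrightarrow> ran (f y |` ran (tmap \<gamma> y)) \<subseteq> ran (tmap \<gamma>' y)) \<and>
        ran (f x |` dom (tmap \<gamma> y)) \<subseteq> dom (tmap \<gamma>' y) \<and>
        (\<forall>a\<in>dom (tmap \<gamma> y). (tmap \<gamma>' y \<circ>\<^sub>m f x) a = (f y \<circ>\<^sub>m tmap \<gamma> y) a)) \<and>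
     (\<forall>h\<in>arrows_from_to \<G> x x.
        ran (f x |` pset (tact \<gamma>) h) \<subseteq> pset (tact \<gamma>') h \<and>
        (\<forall>a\<in>pset (tact \<gamma>) (ginv \<G> h).
           (pmap (tact \<gamma>') h \<circ>\<^sub>m f x) a = (f x \<circ>\<^sub>m pmap (tact \<gamma>) h) a))"

definition Dcat ::
    "'g groupoid_data \<Rightarrow> 'g \<Rightarrow> ('g \<Rightarrow> 'g) \<Rightarrow> (('g, 'a::ring) tdata, ('g, 'a) family) cat" where
  "Dcat \<G> x \<tau> = \<lparr>
     Ob = {\<gamma>. transversal_data \<G> x \<tau> \<gamma>},
     Hom = (\<lambda>\<gamma> \<gamma>'. {f. tdata_morphism \<G> x \<gamma> \<gamma>' f}),
     Ident = (\<lambda>\<gamma>. \<lambda>y\<in>objs \<G>. pid (tset \<gamma> y)),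
     Comp = family_comp (objs \<G>)\<rparr>"

section \<open>The functors\<close>

definition Ffun :: "'g groupoid_data \<Rightarrow> 'g \<Rightarrow> ('g \<Rightarrow> 'g) \<Rightarrow>
    (('g, 'a::ring) paction, ('g, 'a) family, ('g, 'a) tdata, ('g, 'a) family) functor_data" where
  "Ffun \<G> x \<tau> = \<lparr>
     fob = (\<lambda>\<alpha>. \<lparr>
       tset = (\<lambda>y\<in>objs \<G>. pset \<alpha> y),
       tmap = (\<lambda>y\<in>objs \<G>. pmap \<alpha> (\<tau> y)),
       tact = \<lparr>pset = (\<lambda>h\<in>arrows_from_to \<G> x x. pset \<alpha> h),
               pmap = (\<lambda>h\<in>arrows_from_to \<G> x x. pmap \<alpha> h)\<rparr>\<rparr>),
     fmor = (\<lambda>\<psi>. \<lambda>y\<in>objs \<G>. \<psi> y)\<rparr>"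

definition Gmap ::
    "'g groupoid_data \<Rightarrow> ('g \<Rightarrow> 'g) \<Rightarrow> ('g, 'a) tdata \<Rightarrow> 'g \<Rightarrow> 'a \<rightharpoonup> 'a" where
  "Gmap \<G> \<tau> \<gamma> g =
     (if g \<in> objs \<G> then pid (tset \<gamma> g)
      else tmap \<gamma> (tgt \<G> g) \<circ>\<^sub>m pmap (tact \<gamma>) (loop_of \<G> \<tau> g) \<circ>\<^sub>m pinv (tmap \<gamma> (src \<G> g)))"

definition Gfun :: "'g groupoid_data \<Rightarrow> ('g \<Rightarrow> 'g) \<Rightarrow>
    (('g, 'a::ring) tdata, ('g, 'a) family, ('g, 'a) paction, ('g, 'a) family) functor_data" where
  "Gfun \<G> \<tau> = \<lparr>
     fob = (\<lambda>\<gamma>. \<lparr>pset = (\<lambda>g\<in>arr \<G>. ran (Gmap \<G> \<tau> \<gamma> g)), pmap = (\<lambda>g\<in>arr \<G>. Gmap \<G> \<tau> \<gamma> g)\<rparr>),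
     fmor = (\<lambda>f. \<lambda>y\<in>objs \<G>. f y)\<rparr>"

section \<open>The constructions are categories and functors\<close>

text \<open>
  The results of this section are Gpar_category, Dcat_category, Ffun_functor and Gfun_functor.
  No definition above depends on them.
\<close>

lemma pid_eq_Some [simp]: "pid S a = Some b \<longleftrightarrow> a \<in> S \<and> b = a"
  by (auto simp: pid_def restrict_map_def)

lemma dom_pid [simp]: "dom (pid S) = S" and ran_pid [simp]: "ran (pid S) = S"
  by (auto simp: dom_def ran_def)

lemma pid_comp: "ran m \<subseteq> S \<Longrightarrow> pid S \<circ>\<^sub>m m = m"
  by (rule ext) (auto simp: map_comp_def pid_def restrict_map_def ran_def split: option.splits)

lemma comp_pid: "dom m = S \<Longrightarrow> m \<circ>\<^sub>m pid S = m"
  by (rule ext) (auto simp: map_comp_def pid_def restrict_map_def dom_def split: option.splits)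

lemma map_comp_assoc: "u \<circ>\<^sub>m v \<circ>\<^sub>m w = u \<circ>\<^sub>m (v \<circ>\<^sub>m w)"
  by (rule ext) (auto simp: map_comp_def split: option.splits)

lemma map_le_Some_iff: "u \<subseteq>\<^sub>m v \<longleftrightarrow> (\<forall>a b. u a = Some b \<longrightarrow> v a = Some b)"
  by (force simp: map_le_def dom_def)

lemma pinv_eq_Some: "inj_on m (dom m) \<Longrightarrow> pinv m b = Some a \<longleftrightarrow> m a = Some b"
  unfolding pinv_def
  by (smt (verit, best) domI inj_on_def mem_Collect_eq option.distinct(1) option.sel ran_def
      the_equality)

lemma ran_restrict_iff: "b \<in> ran (m |` S) \<longleftrightarrow> (\<exists>a\<in>S. m a = Some b)"
  by (auto simp: ran_def restrict_map_def)

lemma ran_iff: "b \<in> ran m \<longleftrightarrow> (\<exists>a. m a = Some b)"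
  by (auto simp: ran_def)

definition closed_ring :: "'a::ring set \<Rightarrow> bool" where
  "closed_ring R \<longleftrightarrow> (\<forall>a\<in>R. \<forall>b\<in>R. a + b \<in> R \<and> a * b \<in> R)"

lemma ideal_of_closed: "ideal_of I R \<Longrightarrow> closed_ring I"
  unfolding ideal_of_def closed_ring_def by blast

lemma ideal_of_Int: "ideal_of I R \<Longrightarrow> ideal_of J R \<Longrightarrow> ideal_of (I \<inter> J) R"
  unfolding ideal_of_def by auto

lemma ideal_of_refl: "ideal_of I R \<Longrightarrow> ideal_of I I"
  unfolding ideal_of_def by blast

lemma ring_homom_iff:
  assumes "closed_ring R"
  shows "ring_homom m R S \<longleftrightarrow> (\<forall>a. a \<in> R \<longleftrightarrow> (\<exists>b. m a = Some b)) \<and> (\<forall>a b. m a = Some b \<longrightarrow> b \<in> S) \<and>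
    (\<forall>a b c d. m a = Some c \<longrightarrow> m b = Some d \<longrightarrow>
       m (a + b) = Some (c + d) \<and> m (a * b) = Some (c * d))" (is "?L \<longleftrightarrow> ?R")
proof
  assume L: ?L
  then have d: "\<And>a. a \<in> R \<longleftrightarrow> (\<exists>b. m a = Some b)" "\<And>a b. m a = Some b \<Longrightarrow> b \<in> S"
    by (auto simp: ring_homom_def ran_def)
  have "m (a + b) = Some (c + d) \<and> m (a * b) = Some (c * d)"
    if e: "m a = Some c" "m b = Some d" for a b c d
  proof -
    have ab: "a \<in> R" "b \<in> R" using e d by auto
    then have "a + b \<in> R" "a * b \<in> R" using assms by (auto simp: closed_ring_def)
    then obtain u v where uv: "m (a + b) = Some u" "m (a * b) = Some v" using d by meson
    have "the (m (a + b)) = the (m a) + the (m b)" "the (m (a * b)) = the (m a) * the (m b)"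
      using L ab by (auto simp: ring_homom_def)
    then show ?thesis using e uv by simp
  qed
  then show ?R using d by blast
next
  assume R: ?R
  have "the (m (a + b)) = the (m a) + the (m b) \<and> the (m (a * b)) = the (m a) * the (m b)"
    if "a \<in> R" "b \<in> R" for a b
  proof -
    have "\<exists>c. m a = Some c" "\<exists>d. m b = Some d" using R that by blast+
    then obtain c d where "m a = Some c" "m b = Some d" by blast
    then show ?thesis using R by simp
  qed
  moreover have "dom m = R" "ran m \<subseteq> S" using R by (auto simp: dom_def ran_def)
  ultimately show ?L unfolding ring_homom_def by blast
qed

lemma ring_homom_comp:
  assumes "closed_ring R" "closed_ring S" "ring_homom m R S" "ring_homom n S T"
  shows "ring_homom (n \<circ>\<^sub>m m) R T"
  using assms(3,4) unfolding ring_homom_iff[OF assms(1)] ring_homom_iff[OF assms(2)]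
  by (auto simp: map_comp_Some_iff; metis)

lemma ring_homom_pid: "closed_ring R \<Longrightarrow> ring_homom (pid R) R R"
  by (simp add: ring_homom_iff) (simp add: closed_ring_def)

lemma ring_homomD:
  "closed_ring R \<Longrightarrow> ring_homom m R S \<Longrightarrow> m a = Some b \<Longrightarrow> a \<in> R \<and> b \<in> S"
  "closed_ring R \<Longrightarrow> ring_homom m R S \<Longrightarrow> a \<in> R \<Longrightarrow> \<exists>b\<in>S. m a = Some b"
  unfolding ring_homom_iff by blast+

lemma ring_isom_dom_ran: "ring_isom m R S \<Longrightarrow> dom m = R \<and> ran m = S \<and> inj_on m (dom m)"
  by (auto simp: ring_isom_def ring_homom_def)

lemma ring_isom_add_mult:
  assumes "ring_isom m R S" "closed_ring R" "m a = Some c" "m b = Some d"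
  shows "m (a + b) = Some (c + d) \<and> m (a * b) = Some (c * d)"
  using assms(1,3,4) unfolding ring_isom_def ring_homom_iff[OF assms(2)] by blast

lemma inj_onD_map: "inj_on m (dom m) \<Longrightarrow> m a = Some c \<Longrightarrow> m b = Some c \<Longrightarrow> a = b"
  by (metis domI inj_onD)

lemma is_functorI:
  assumes "\<And>a. a \<in> Ob C \<Longrightarrow> fob F a \<in> Ob D"
    "\<And>a. a \<in> Ob C \<Longrightarrow> fmor F (Ident C a) = Ident D (fob F a)"
    "\<And>a b f. a \<in> Ob C \<Longrightarrow> b \<in> Ob C \<Longrightarrow> f \<in> Hom C a b \<Longrightarrow> fmor F f \<in> Hom D (fob F a) (fob F b)"
    "\<And>f g. fmor F (Comp C g f) = Comp D (fmor F g) (fmor F f)"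
  shows "is_functor C D F"
  using assms unfolding is_functor_def by blast

locale groupoid_loc =
  fixes \<G> :: "'g groupoid_data" (structure)
  assumes groupoid: "groupoid \<G>"
begin

lemma src_tgt [simp, intro]: "g \<in> arr \<G> \<Longrightarrow> src \<G> g \<in> objs \<G>" "g \<in> arr \<G> \<Longrightarrow> tgt \<G> g \<in> objs \<G>"
  using groupoid by (auto simp: groupoid_def)

lemma objsD [simp]: "y \<in> objs \<G> \<Longrightarrow> y \<in> arr \<G>" "y \<in> objs \<G> \<Longrightarrow> src \<G> y = y"
    "y \<in> objs \<G> \<Longrightarrow> tgt \<G> y = y"
  by (auto simp: objs_def)

lemma mul [simp]:
  assumes "g \<in> arr \<G>" "h \<in> arr \<G>" "src \<G> g = tgt \<G> h"
  shows "g \<cdot> h \<in> arr \<G>" "src \<G> (g \<cdot> h) = src \<G> h" "tgt \<G> (g \<cdot> h) = tgt \<G> g"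
  using groupoid assms by (auto simp: groupoid_def)

lemma assoc:
  assumes "g \<in> arr \<G>" "h \<in> arr \<G>" "k \<in> arr \<G>" "src \<G> g = tgt \<G> h" "src \<G> h = tgt \<G> k"
  shows "g \<cdot> h \<cdot> k = g \<cdot> (h \<cdot> k)"
  using groupoid assms unfolding groupoid_def by blast

lemma unit [simp]: "g \<in> arr \<G> \<Longrightarrow> g \<cdot> src \<G> g = g" "g \<in> arr \<G> \<Longrightarrow> tgt \<G> g \<cdot> g = g"
  using groupoid by (auto simp: groupoid_def)

lemma ginv_unique:
  assumes "g \<in> arr \<G>" "h \<in> arr \<G>" "src \<G> h = tgt \<G> g" "h \<cdot> g = src \<G> g"
    "k \<in> arr \<G>" "tgt \<G> k = src \<G> g" "g \<cdot> k = tgt \<G> g"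
  shows "h = k"
proof -
  have "h = h \<cdot> (g \<cdot> k)" using assms unit(1)[of h] by metis
  also have "\<dots> = h \<cdot> g \<cdot> k" using assms assoc[of h g k] by metis
  also have "\<dots> = k" using assms unit(2)[of k] by metis
  finally show ?thesis .
qed

lemma ginv:
  assumes "g \<in> arr \<G>"
  shows "ginv \<G> g \<in> arr \<G> \<and> src \<G> (ginv \<G> g) = tgt \<G> g \<and> tgt \<G> (ginv \<G> g) = src \<G> g \<and>
     ginv \<G> g \<cdot> g = src \<G> g \<and> g \<cdot> ginv \<G> g = tgt \<G> g"
  unfolding ginv_def
proof (rule theI', rule ex_ex1I)
  show "\<exists>h. h \<in> arr \<G> \<and> src \<G> h = tgt \<G> g \<and> tgt \<G> h = src \<G> g \<and> h \<cdot> g = src \<G> g \<and> g \<cdot> h = tgt \<G> g"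
    using groupoid assms unfolding groupoid_def by blast
qed (use ginv_unique assms in blast)

lemmas ginv_simps [simp] = ginv[THEN conjunct1] ginv[THEN conjunct2, THEN conjunct1]
  ginv[THEN conjunct2, THEN conjunct2, THEN conjunct1]
  ginv[THEN conjunct2, THEN conjunct2, THEN conjunct2, THEN conjunct1]
  ginv[THEN conjunct2, THEN conjunct2, THEN conjunct2, THEN conjunct2]

lemma ginv_eqI:
  assumes "g \<in> arr \<G>" "h \<in> arr \<G>" "src \<G> h = tgt \<G> g" "h \<cdot> g = src \<G> g"
  shows "ginv \<G> g = h"
  using ginv_unique[of g h "ginv \<G> g"] assms by simp

lemma ginv_ginv [simp]: "g \<in> arr \<G> \<Longrightarrow> ginv \<G> (ginv \<G> g) = g"
  by (rule ginv_eqI) auto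

lemma ginv_obj [simp]: "y \<in> objs \<G> \<Longrightarrow> ginv \<G> y = y"
  using unit(1)[of y] by (intro ginv_eqI) auto

lemma cancel1 [simp]:
  assumes "g \<in> arr \<G>" "h \<in> arr \<G>" "tgt \<G> g = tgt \<G> h"
  shows "g \<cdot> (ginv \<G> g \<cdot> h) = h"
  using assms unit(2)[of h] assoc[of g "ginv \<G> g" h] by simp

lemma cancel2 [simp]:
  assumes "g \<in> arr \<G>" "h \<in> arr \<G>" "src \<G> g = tgt \<G> h"
  shows "ginv \<G> g \<cdot> (g \<cdot> h) = h"
  using assms unit(2)[of h] assoc[of "ginv \<G> g" g h] by simp

lemma ginv_mul:
  assumes "g \<in> arr \<G>" "h \<in> arr \<G>" "src \<G> g = tgt \<G> h"
  shows "ginv \<G> (g \<cdot> h) = ginv \<G> h \<cdot> ginv \<G> g"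
proof (rule ginv_eqI)
  have "ginv \<G> h \<cdot> ginv \<G> g \<cdot> (g \<cdot> h) = ginv \<G> h \<cdot> (ginv \<G> g \<cdot> (g \<cdot> h))"
    using assms by (intro assoc) auto
  then show "ginv \<G> h \<cdot> ginv \<G> g \<cdot> (g \<cdot> h) = src \<G> (g \<cdot> h)" using assms by simp
qed (use assms in auto)

lemma isotropy_simps [simp]: "arr (isotropy \<G> x) = arrows_from_to \<G> x x"
  "src (isotropy \<G> x) = src \<G>" "tgt (isotropy \<G> x) = tgt \<G>" "mul (isotropy \<G> x) = mul \<G>"
  by (simp_all add: isotropy_def)

lemma objs_isotropy: "x \<in> objs \<G> \<Longrightarrow> objs (isotropy \<G> x) = {x}"
  unfolding objs_def arrows_from_to_def isotropy_simps set_eq_iff mem_Collect_eq singleton_iff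
  by metis

lemma groupoid_isotropy:
  assumes x: "x \<in> objs \<G>"
  shows "groupoid_loc (isotropy \<G> x)"
proof
  have "\<exists>h\<in>arrows_from_to \<G> x x. src \<G> h = tgt \<G> g \<and> tgt \<G> h = src \<G> g \<and> h \<cdot> g = src \<G> g \<and> g \<cdot> h = tgt \<G> g"
    if "g \<in> arrows_from_to \<G> x x" for g
    using that by (intro bexI[of _ "ginv \<G> g"]) (auto simp: arrows_from_to_def)
  moreover have "g \<cdot> x = g \<and> x \<cdot> g = g" if "g \<in> arrows_from_to \<G> x x" for g
    using that unit[of g] by (auto simp: arrows_from_to_def)
  moreover have H: "g \<in> arr \<G>" "src \<G> g = x" "tgt \<G> g = x" if "g \<in> arrows_from_to \<G> x x" for g
    using that by (simp_all add: arrows_from_to_def)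
  moreover have "g \<cdot> h \<in> arrows_from_to \<G> x x"
    if "g \<in> arrows_from_to \<G> x x" "h \<in> arrows_from_to \<G> x x" for g h
    using mul[of g h] H[OF that(1)] H[OF that(2)] by (simp add: arrows_from_to_def)
  moreover have "g \<cdot> h \<cdot> k = g \<cdot> (h \<cdot> k)"
    if "g \<in> arrows_from_to \<G> x x" "h \<in> arrows_from_to \<G> x x" "k \<in> arrows_from_to \<G> x x" for g h k
    using assoc[of g h k] H[OF that(1)] H[OF that(2)] H[OF that(3)] by simp
  ultimately show "groupoid (isotropy \<G> x)"
    unfolding groupoid_def objs_isotropy[OF x] isotropy_simps by (intro conjI ballI impI) simp_all
qed

lemma ginv_isotropy:
  assumes x: "x \<in> objs \<G>" and g: "g \<in> arrows_from_to \<G> x x"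
  shows "ginv (isotropy \<G> x) g = ginv \<G> g"
  by (rule groupoid_loc.ginv_eqI[OF groupoid_isotropy[OF x]])
    (use g in \<open>auto simp: arrows_from_to_def\<close>)

end

locale partial_action_loc = groupoid_loc +
  fixes R :: "'a::ring set" and \<alpha>
  assumes pa: "partial_action \<G> R \<alpha>"
begin

lemma
  assumes "g \<in> arr \<G>"
  shows tgt_ideal: "ideal_of (pset \<alpha> (tgt \<G> g)) R"
    and g_ideal: "ideal_of (pset \<alpha> g) (pset \<alpha> (tgt \<G> g))"
    and iso: "ring_isom (pmap \<alpha> g) (pset \<alpha> (ginv \<G> g)) (pset \<alpha> g)"
  using pa assms by (auto simp: partial_action_def)

lemma obj_ideal: "y \<in> objs \<G> \<Longrightarrow> ideal_of (pset \<alpha> y) R"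
  using tgt_ideal[of y] by simp

lemma map_obj: "y \<in> objs \<G> \<Longrightarrow> pmap \<alpha> y = pid (pset \<alpha> y)"
  using pa by (auto simp: partial_action_def)

lemma dom_map: "g \<in> arr \<G> \<Longrightarrow> dom (pmap \<alpha> g) = pset \<alpha> (ginv \<G> g)"
  and ran_map: "g \<in> arr \<G> \<Longrightarrow> ran (pmap \<alpha> g) = pset \<alpha> g"
  and inj_map: "g \<in> arr \<G> \<Longrightarrow> inj_on (pmap \<alpha> g) (dom (pmap \<alpha> g))"
  using iso[THEN ring_isom_dom_ran, of g] by auto

lemma in_dom: "g \<in> arr \<G> \<Longrightarrow> pmap \<alpha> g a = Some b \<Longrightarrow> a \<in> pset \<alpha> (ginv \<G> g)"
  and in_ran: "g \<in> arr \<G> \<Longrightarrow> pmap \<alpha> g a = Some b \<Longrightarrow> b \<in> pset \<alpha> g"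
  and domE: "g \<in> arr \<G> \<Longrightarrow> a \<in> pset \<alpha> (ginv \<G> g) \<Longrightarrow> \<exists>b. pmap \<alpha> g a = Some b"
  and ranE: "g \<in> arr \<G> \<Longrightarrow> b \<in> pset \<alpha> g \<Longrightarrow> \<exists>a. pmap \<alpha> g a = Some b"
  using dom_map[of g] ran_map[of g] by (auto simp: dom_def ran_def)

lemma compose:
  assumes "g \<in> arr \<G>" "h \<in> arr \<G>" "src \<G> g = tgt \<G> h" "pmap \<alpha> h a = Some b" "pmap \<alpha> g b = Some c"
  shows "pmap \<alpha> (g \<cdot> h) a = Some c"
proof -
  have "pmap \<alpha> g \<circ>\<^sub>m pmap \<alpha> h \<subseteq>\<^sub>m pmap \<alpha> (g \<cdot> h)"
    using pa assms by (auto simp: partial_action_def)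
  moreover have "(pmap \<alpha> g \<circ>\<^sub>m pmap \<alpha> h) a = Some c" using assms by simp
  ultimately show ?thesis by (auto simp: map_le_Some_iff)
qed

lemma subset_tgt: "g \<in> arr \<G> \<Longrightarrow> pset \<alpha> g \<subseteq> pset \<alpha> (tgt \<G> g)"
  using g_ideal by (auto simp: ideal_of_def)

lemma map_ginv:
  assumes g: "g \<in> arr \<G>"
  shows "pmap \<alpha> (ginv \<G> g) b = Some a \<longleftrightarrow> pmap \<alpha> g a = Some b"
proof -
  have *: "pmap \<alpha> (ginv \<G> g) b = Some a" if g: "g \<in> arr \<G>" and e: "pmap \<alpha> g a = Some b" for g a b
  proof -
    have "b \<in> pset \<alpha> (ginv \<G> (ginv \<G> g))" using in_ran[OF g e] g by simp
    then obtain c where c: "pmap \<alpha> (ginv \<G> g) b = Some c" using domE[of "ginv \<G> g" b] g by auto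
    have "pmap \<alpha> (src \<G> g) a = Some c" using compose[OF _ _ _ e c] g by simp
    then have "c = a" using g by (simp add: map_obj)
    then show ?thesis using c by simp
  qed
  show ?thesis using *[OF g] *[of "ginv \<G> g" b a] g by auto
qed

lemma image:
  assumes "g \<in> arr \<G>" "h \<in> arr \<G>" "src \<G> g = tgt \<G> h"
  shows "ran (pmap \<alpha> g |` (pset \<alpha> (ginv \<G> g) \<inter> pset \<alpha> h)) = pset \<alpha> g \<inter> pset \<alpha> (g \<cdot> h)"
proof -
  have 1: "c \<in> pset \<alpha> (g \<cdot> h)" if "a \<in> pset \<alpha> h" "pmap \<alpha> g a = Some c" "g \<in> arr \<G>" "h \<in> arr \<G>" "src \<G> g = tgt \<G> h"
    for g h a c
  proof -
    have "\<exists>b. pmap \<alpha> h b = Some a" using ranE that by blast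
    then obtain b where "pmap \<alpha> h b = Some a" by blast
    then show ?thesis using that by (metis compose in_ran mul(1))
  qed
  have "a \<in> pset \<alpha> (ginv \<G> g) \<and> a \<in> pset \<alpha> h" if "c \<in> pset \<alpha> (g \<cdot> h)" "pmap \<alpha> g a = Some c" for a c
    using 1[of c "g \<cdot> h" "ginv \<G> g" a] that assms in_dom by (auto simp: map_ginv)
  then show ?thesis using assms 1 ranE[of g] in_ran[of g]
    by (auto simp: ran_restrict_iff) blast+
qed

end

context groupoid_loc begin

lemma par_morphism_comp:
  assumes A: "partial_action \<G> R \<alpha>" and A': "partial_action \<G> R \<alpha>'"
    and m: "par_morphism \<G> \<alpha> \<alpha>' \<psi>" and m': "par_morphism \<G> \<alpha>' \<alpha>'' \<psi>'"
  shows "par_morphism \<G> \<alpha> \<alpha>'' (family_comp (objs \<G>) \<psi>' \<psi>)"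
proof -
  interpret A: partial_action_loc \<G> R \<alpha> using A by unfold_locales
  interpret A': partial_action_loc \<G> R \<alpha>' using A' by unfold_locales
  have hom: "ring_homom (\<psi>' y \<circ>\<^sub>m \<psi> y) (pset \<alpha> y) (pset \<alpha>'' y)" if "y \<in> objs \<G>" for y
    by (rule ring_homom_comp[of _ "pset \<alpha>' y"])
      (use m m' that A.obj_ideal[THEN ideal_of_closed] A'.obj_ideal[THEN ideal_of_closed]
       in \<open>auto simp: par_morphism_def\<close>)
  have sub: "ran ((\<psi>' (tgt \<G> g) \<circ>\<^sub>m \<psi> (tgt \<G> g)) |` pset \<alpha> g) \<subseteq> pset \<alpha>'' g" if g: "g \<in> arr \<G>" for g
  proof -
    have "ran (\<psi> (tgt \<G> g) |` pset \<alpha> g) \<subseteq> pset \<alpha>' g" "ran (\<psi>' (tgt \<G> g) |` pset \<alpha>' g) \<subseteq> pset \<alpha>'' g"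
      using m m' g by (auto simp: par_morphism_def)
    then show ?thesis unfolding subset_iff ran_restrict_iff by (fastforce simp: map_comp_Some_iff)
  qed
  have comm: "(pmap \<alpha>'' g \<circ>\<^sub>m (\<psi>' (src \<G> g) \<circ>\<^sub>m \<psi> (src \<G> g))) a =
        (\<psi>' (tgt \<G> g) \<circ>\<^sub>m \<psi> (tgt \<G> g) \<circ>\<^sub>m pmap \<alpha> g) a"
    if g: "g \<in> arr \<G>" and a: "a \<in> pset \<alpha> (ginv \<G> g)" for g a
  proof -
    have 1: "(pmap \<alpha>' g \<circ>\<^sub>m \<psi> (src \<G> g)) a = (\<psi> (tgt \<G> g) \<circ>\<^sub>m pmap \<alpha> g) a"
      and 2: "\<And>b. b \<in> pset \<alpha>' (ginv \<G> g) \<Longrightarrow> (pmap \<alpha>'' g \<circ>\<^sub>m \<psi>' (src \<G> g)) b = (\<psi>' (tgt \<G> g) \<circ>\<^sub>m pmap \<alpha>' g) b"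
      using m m' g a by (auto simp: par_morphism_def)
    have h: "ring_homom (\<psi> (src \<G> g)) (pset \<alpha> (src \<G> g)) (pset \<alpha>' (src \<G> g))"
      and i: "ran (\<psi> (src \<G> g) |` pset \<alpha> (ginv \<G> g)) \<subseteq> pset \<alpha>' (ginv \<G> g)"
      using m g ginv[OF g] unfolding par_morphism_def by (auto dest!: bspec[of _ _ "ginv \<G> g"])
    have "a \<in> pset \<alpha> (src \<G> g)" using A.subset_tgt[of "ginv \<G> g"] a g by auto
    then obtain b where b: "\<psi> (src \<G> g) a = Some b" using h unfolding ring_homom_def by blast
    then have "b \<in> pset \<alpha>' (ginv \<G> g)" using i a by (auto simp: subset_iff ran_restrict_iff)
    from 2[OF this] have "(pmap \<alpha>'' g \<circ>\<^sub>m (\<psi>' (src \<G> g) \<circ>\<^sub>m \<psi> (src \<G> g))) a = (\<psi>' (tgt \<G> g) \<circ>\<^sub>m pmap \<alpha>' g) b"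
      using b by (simp add: map_comp_def)
    also have "\<dots> = (\<psi>' (tgt \<G> g) \<circ>\<^sub>m (pmap \<alpha>' g \<circ>\<^sub>m \<psi> (src \<G> g))) a" using b by (simp add: map_comp_def)
    also have "\<dots> = (\<psi>' (tgt \<G> g) \<circ>\<^sub>m (\<psi> (tgt \<G> g) \<circ>\<^sub>m pmap \<alpha> g)) a" using 1 by (simp add: map_comp_def)
    finally show ?thesis by (simp add: map_comp_assoc)
  qed
  show ?thesis unfolding par_morphism_def family_comp_def
    using hom sub comm by auto
qed

lemma family_comp_assoc:
  "family_comp Y h (family_comp Y g f) = family_comp Y (family_comp Y h g) f"
  by (rule ext) (simp add: family_comp_def map_comp_assoc)

lemma family_comp_pid:
  assumes "f \<in> extensional Y" "\<And>y. y \<in> Y \<Longrightarrow> ring_homom (f y) (S y) (T y)"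
  shows "family_comp Y f (\<lambda>y\<in>Y. pid (S y)) = f" "family_comp Y (\<lambda>y\<in>Y. pid (T y)) f = f"
  using assms by (auto simp: family_comp_def extensional_def ring_homom_def fun_eq_iff[of _ f] comp_pid pid_comp)

lemma Gpar_category: "is_category (Gpar \<G> :: (('g, 'a::ring) paction, ('g, 'a) family) cat)"
proof -
  have "par_morphism \<G> \<alpha> \<alpha> (\<lambda>y\<in>objs \<G>. pid (pset \<alpha> y))" if \<alpha>: "partial_action \<G> UNIV \<alpha>"
    for \<alpha> :: "('g, 'a) paction"
  proof -
    interpret A: partial_action_loc \<G> UNIV \<alpha> using \<alpha> by unfold_locales
    have "pset \<alpha> (ginv \<G> g) \<subseteq> pset \<alpha> (src \<G> g)" "pset \<alpha> g \<subseteq> pset \<alpha> (tgt \<G> g)" if "g \<in> arr \<G>" for g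
      using A.subset_tgt[of "ginv \<G> g"] A.subset_tgt[of g] that by auto
    moreover have "pid (pset \<alpha> (tgt \<G> g)) \<circ>\<^sub>m pmap \<alpha> g = pmap \<alpha> g" if "g \<in> arr \<G>" for g
      using pid_comp A.ran_map A.subset_tgt that by metis
    ultimately show ?thesis unfolding par_morphism_def
      using ring_homom_pid A.obj_ideal ideal_of_closed
      by (fastforce simp: ran_restrict_iff map_comp_def pid_def)
  qed
  then show ?thesis unfolding is_category_def Gpar_def
    apply (auto simp: par_morphism_comp family_comp_assoc)
    by (rule family_comp_pid; auto simp: par_morphism_def)+
qed

end

locale transversal_loc = groupoid_loc +
  fixes x and \<tau> :: "'g \<Rightarrow> 'g"
  assumes x [simp]: "x \<in> objs \<G>" and transversal: "transversal \<G> x \<tau>"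
begin

lemma tau [simp]:
  assumes "y \<in> objs \<G>"
  shows "\<tau> y \<in> arr \<G>" "src \<G> (\<tau> y) = x" "tgt \<G> (\<tau> y) = y"
  using transversal assms by (auto simp: transversal_def arrows_from_to_def)

lemma tau_x [simp]: "\<tau> x = x"
  using transversal by (simp add: transversal_def)

lemma loop [simp]:
  assumes "g \<in> arr \<G>"
  shows "loop_of \<G> \<tau> g \<in> arr \<G>" "src \<G> (loop_of \<G> \<tau> g) = x" "tgt \<G> (loop_of \<G> \<tau> g) = x"
  using assms by (auto simp: loop_of_def)

lemma loop_isotropy [simp]: "g \<in> arr \<G> \<Longrightarrow> loop_of \<G> \<tau> g \<in> arrows_from_to \<G> x x"
  by (simp add: arrows_from_to_def)

lemma loop_ginv: "g \<in> arr \<G> \<Longrightarrow> loop_of \<G> \<tau> (ginv \<G> g) = ginv \<G> (loop_of \<G> \<tau> g)"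
  by (simp add: loop_of_def ginv_mul assoc)

lemma loop_mul:
  assumes "g \<in> arr \<G>" "h \<in> arr \<G>" "src \<G> g = tgt \<G> h"
  shows "loop_of \<G> \<tau> (g \<cdot> h) = loop_of \<G> \<tau> g \<cdot> loop_of \<G> \<tau> h"
  using assms by (simp add: loop_of_def assoc)

lemma loop_obj: "y \<in> objs \<G> \<Longrightarrow> loop_of \<G> \<tau> y = x"
  using unit(1)[of "ginv \<G> (\<tau> y)"] by (simp add: loop_of_def)

lemma tau_loop:
  assumes "g \<in> arr \<G>"
  shows "\<tau> (tgt \<G> g) \<cdot> loop_of \<G> \<tau> g = g \<cdot> \<tau> (src \<G> g)"
  using assms by (simp add: loop_of_def assoc)

lemma tau_loop_ginv:
  assumes "g \<in> arr \<G>"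
  shows "\<tau> (tgt \<G> g) \<cdot> (loop_of \<G> \<tau> g \<cdot> ginv \<G> (\<tau> (src \<G> g))) = g"
  using assms unit(1)[of g] by (simp add: loop_of_def assoc)

lemma ginv_isotropy_x [simp]: "h \<in> arrows_from_to \<G> x x \<Longrightarrow> ginv (isotropy \<G> x) h = ginv \<G> h"
  by (simp add: ginv_isotropy)

end

locale tdata_loc = transversal_loc +
  fixes \<gamma> :: "('g, 'a::ring) tdata"
  assumes td: "transversal_data \<G> x \<tau> \<gamma>"
begin

sublocale act: partial_action_loc "isotropy \<G> x" "tset \<gamma> x" "tact \<gamma>"
  using groupoid_isotropy[OF x] td
  unfolding partial_action_loc_def partial_action_loc_axioms_def transversal_data_def
    partial_group_action_def by blast

lemma tset_ideal: "y \<in> objs \<G> \<Longrightarrow> ideal_of (tset \<gamma> y) UNIV"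
  and tmap_iso: "y \<in> objs \<G> \<Longrightarrow> ring_isom (tmap \<gamma> y) (dom (tmap \<gamma> y)) (ran (tmap \<gamma> y))"
  and act_x: "pset (tact \<gamma>) x = tset \<gamma> x"
  and tmap_x: "tmap \<gamma> x = pid (tset \<gamma> x)"
  and ran_ideal: "y \<in> objs \<G> \<Longrightarrow> ideal_of (ran (tmap \<gamma> y)) (tset \<gamma> y)"
  and dom_ideal: "y \<in> objs \<G> \<Longrightarrow> ideal_of (dom (tmap \<gamma> y)) (tset \<gamma> x)"
  using td by (auto simp: transversal_data_def partial_group_action_def)

lemma pmap_x: "pmap (tact \<gamma>) x = pid (tset \<gamma> x)"
  using td by (auto simp: transversal_data_def)

lemma tmap_inj: "y \<in> objs \<G> \<Longrightarrow> inj_on (tmap \<gamma> y) (dom (tmap \<gamma> y))"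
  using tmap_iso by (auto simp: ring_isom_def)

lemma tmap_hom:
  assumes "y \<in> objs \<G>" "tmap \<gamma> y a = Some c" "tmap \<gamma> y b = Some d"
  shows "tmap \<gamma> y (a + b) = Some (c + d) \<and> tmap \<gamma> y (a * b) = Some (c * d)"
  using ring_isom_add_mult[OF tmap_iso] dom_ideal[THEN ideal_of_closed] assms by blast

lemma act_hom:
  assumes "h \<in> arrows_from_to \<G> x x" "pmap (tact \<gamma>) h a = Some c" "pmap (tact \<gamma>) h b = Some d"
  shows "pmap (tact \<gamma>) h (a + b) = Some (c + d) \<and> pmap (tact \<gamma>) h (a * b) = Some (c * d)"
proof -
  have h: "h \<in> arr (isotropy \<G> x)" using assms by simp
  have "closed_ring (pset (tact \<gamma>) (ginv (isotropy \<G> x) h))"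
    using act.g_ideal[THEN ideal_of_closed] act.ginv[OF h] by blast
  then show ?thesis using ring_isom_add_mult[OF act.iso[OF h]] assms by blast
qed

lemma Gmap_obj: "y \<in> objs \<G> \<Longrightarrow> Gmap \<G> \<tau> \<gamma> y = pid (tset \<gamma> y)"
  by (simp add: Gmap_def)

lemma Gmap_eq_Some:
  assumes "g \<in> arr \<G>" "g \<notin> objs \<G>"
  shows "Gmap \<G> \<tau> \<gamma> g a = Some d \<longleftrightarrow>
    (\<exists>b c. tmap \<gamma> (src \<G> g) b = Some a \<and> pmap (tact \<gamma>) (loop_of \<G> \<tau> g) b = Some c \<and>
       tmap \<gamma> (tgt \<G> g) c = Some d)"
  using assms by (auto simp: Gmap_def map_comp_Some_iff pinv_eq_Some tmap_inj)

lemma Gmap_ginv: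
  assumes g: "g \<in> arr \<G>"
  shows "Gmap \<G> \<tau> \<gamma> (ginv \<G> g) d = Some a \<longleftrightarrow> Gmap \<G> \<tau> \<gamma> g a = Some d"
proof (cases "g \<in> objs \<G>")
  case True
  then show ?thesis by (auto simp: Gmap_obj)
next
  case False
  then have "ginv \<G> g \<notin> objs \<G>" using g ginv_obj ginv_ginv by metis
  then show ?thesis
    using g False act.map_ginv[of "loop_of \<G> \<tau> g"]
    by (auto simp: Gmap_eq_Some loop_ginv)
qed

lemma ran_Gmap:
  assumes g: "g \<in> arr \<G>" "g \<notin> objs \<G>"
  shows "ran (Gmap \<G> \<tau> \<gamma> g) =
    ran (tmap \<gamma> (tgt \<G> g) |`
             (dom (tmap \<gamma> (tgt \<G> g)) \<inter>
              ran (pmap (tact \<gamma>) (loop_of \<G> \<tau> g) |`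
                (dom (tmap \<gamma> (src \<G> g)) \<inter> pset (tact \<gamma>) (ginv \<G> (loop_of \<G> \<tau> g))))))"
proof -
  have "b \<in> pset (tact \<gamma>) (ginv \<G> (loop_of \<G> \<tau> g))" if "pmap (tact \<gamma>) (loop_of \<G> \<tau> g) b = Some c" for b c
    using act.in_dom[of "loop_of \<G> \<tau> g"] g that by simp
  then have "(\<exists>a. Gmap \<G> \<tau> \<gamma> g a = Some d) \<longleftrightarrow>
      (\<exists>c. (c \<in> dom (tmap \<gamma> (tgt \<G> g)) \<and>
         (\<exists>b. (b \<in> dom (tmap \<gamma> (src \<G> g)) \<and> b \<in> pset (tact \<gamma>) (ginv \<G> (loop_of \<G> \<tau> g))) \<and>
            pmap (tact \<gamma>) (loop_of \<G> \<tau> g) b = Some c)) \<and> tmap \<gamma> (tgt \<G> g) c = Some d)" for d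
    unfolding Gmap_eq_Some[OF g] dom_def mem_Collect_eq by blast
  then show ?thesis
    unfolding set_eq_iff ran_iff[of _ "Gmap \<G> \<tau> \<gamma> g"] ran_restrict_iff Int_iff Bex_def by simp
qed

lemma ran_Gmap_ideal:
  assumes g: "g \<in> arr \<G>"
  shows "ideal_of (ran (Gmap \<G> \<tau> \<gamma> g)) (tset \<gamma> (tgt \<G> g))"
proof (cases "g \<in> objs \<G>")
  case True
  then show ?thesis using tset_ideal[THEN ideal_of_refl] by (simp add: Gmap_obj)
next
  case False
  then show ?thesis unfolding ran_Gmap[OF g False]
    using td g unfolding transversal_data_def by blast
qed

lemma dom_Gmap: "g \<in> arr \<G> \<Longrightarrow> dom (Gmap \<G> \<tau> \<gamma> g) = ran (Gmap \<G> \<tau> \<gamma> (ginv \<G> g))"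
  unfolding set_eq_iff ran_iff dom_def mem_Collect_eq by (simp add: Gmap_ginv)

lemma Gmap_iso:
  assumes g: "g \<in> arr \<G>"
  shows "ring_isom (Gmap \<G> \<tau> \<gamma> g) (ran (Gmap \<G> \<tau> \<gamma> (ginv \<G> g))) (ran (Gmap \<G> \<tau> \<gamma> g))"
proof -
  have cl: "closed_ring (ran (Gmap \<G> \<tau> \<gamma> (ginv \<G> g)))"
    using ran_Gmap_ideal[of "ginv \<G> g"] ideal_of_closed g by auto
  have hom: "Gmap \<G> \<tau> \<gamma> g (a + b) = Some (c + d) \<and> Gmap \<G> \<tau> \<gamma> g (a * b) = Some (c * d)"
    if e: "Gmap \<G> \<tau> \<gamma> g a = Some c" "Gmap \<G> \<tau> \<gamma> g b = Some d" for a b c d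
  proof (cases "g \<in> objs \<G>")
    case True
    then show ?thesis using e tset_ideal[OF True, THEN ideal_of_closed]
      by (auto simp: Gmap_obj closed_ring_def)
  next
    case False
    have s: "src \<G> g \<in> objs \<G>" "tgt \<G> g \<in> objs \<G>" "loop_of \<G> \<tau> g \<in> arrows_from_to \<G> x x"
      using g by auto
    obtain a1 a2 where 1: "tmap \<gamma> (src \<G> g) a1 = Some a" "pmap (tact \<gamma>) (loop_of \<G> \<tau> g) a1 = Some a2"
       "tmap \<gamma> (tgt \<G> g) a2 = Some c" using e(1) Gmap_eq_Some[OF g False] by blast
    obtain b1 b2 where 2: "tmap \<gamma> (src \<G> g) b1 = Some b" "pmap (tact \<gamma>) (loop_of \<G> \<tau> g) b1 = Some b2"
       "tmap \<gamma> (tgt \<G> g) b2 = Some d" using e(2) Gmap_eq_Some[OF g False] by blast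
    show ?thesis unfolding Gmap_eq_Some[OF g False]
      using tmap_hom[OF s(1) 1(1) 2(1)] act_hom[OF s(3) 1(2) 2(2)] tmap_hom[OF s(2) 1(3) 2(3)] by blast
  qed
  have D: "a \<in> ran (Gmap \<G> \<tau> \<gamma> (ginv \<G> g)) \<longleftrightarrow> (\<exists>b. Gmap \<G> \<tau> \<gamma> g a = Some b)" for a
    using Gmap_ginv[OF g] by (auto simp: ran_iff)
  have "ring_homom (Gmap \<G> \<tau> \<gamma> g) (ran (Gmap \<G> \<tau> \<gamma> (ginv \<G> g))) (ran (Gmap \<G> \<tau> \<gamma> g))"
    unfolding ring_homom_iff[OF cl]
  proof (intro conjI allI)
    show "a \<in> ran (Gmap \<G> \<tau> \<gamma> (ginv \<G> g)) \<longleftrightarrow> (\<exists>b. Gmap \<G> \<tau> \<gamma> g a = Some b)" for a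
      by (rule D)
  qed (use hom ranI[of "Gmap \<G> \<tau> \<gamma> g"] in blast)+
  moreover have "inj_on (Gmap \<G> \<tau> \<gamma> g) (ran (Gmap \<G> \<tau> \<gamma> (ginv \<G> g)))"
  proof (rule inj_onI)
    fix a b assume a: "a \<in> ran (Gmap \<G> \<tau> \<gamma> (ginv \<G> g))" and e: "Gmap \<G> \<tau> \<gamma> g a = Gmap \<G> \<tau> \<gamma> g b"
    then obtain c where c: "Gmap \<G> \<tau> \<gamma> g a = Some c" using D by blast
    then have "Gmap \<G> \<tau> \<gamma> g b = Some c" using e by simp
    then have "Gmap \<G> \<tau> \<gamma> (ginv \<G> g) c = Some a" "Gmap \<G> \<tau> \<gamma> (ginv \<G> g) c = Some b"
      using c Gmap_ginv[OF g] by blast+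
    then show "a = b" by simp
  qed
  ultimately show ?thesis unfolding ring_isom_def by blast
qed

lemma Gmap_compose:
  assumes g: "g \<in> arr \<G>" and h: "h \<in> arr \<G>" and gh: "src \<G> g = tgt \<G> h"
    and a: "Gmap \<G> \<tau> \<gamma> h a = Some b" and b: "Gmap \<G> \<tau> \<gamma> g b = Some c"
  shows "Gmap \<G> \<tau> \<gamma> (g \<cdot> h) a = Some c"
proof -
  consider "g \<in> objs \<G>" | "h \<in> objs \<G>" | "g \<notin> objs \<G>" "h \<notin> objs \<G>" by blast
  then show ?thesis
  proof cases
    case 1
    then show ?thesis using a b gh h by (auto simp: Gmap_obj)
  next
    case 2
    then show ?thesis using a b gh g unit(1)[of g] by (auto simp: Gmap_obj)
  next
    case 3
    obtain a1 a2 where 1: "tmap \<gamma> (src \<G> h) a1 = Some a" "pmap (tact \<gamma>) (loop_of \<G> \<tau> h) a1 = Some a2"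
       "tmap \<gamma> (tgt \<G> h) a2 = Some b" using a Gmap_eq_Some[OF h 3(2)] by blast
    obtain b1 b2 where 2: "tmap \<gamma> (src \<G> g) b1 = Some b" "pmap (tact \<gamma>) (loop_of \<G> \<tau> g) b1 = Some b2"
       "tmap \<gamma> (tgt \<G> g) b2 = Some c" using b Gmap_eq_Some[OF g 3(1)] by blast
    have "a2 = b1" using inj_onD_map[OF tmap_inj[OF src_tgt(2)[OF h]]] 1(3) 2(1) gh by simp
    then have 3: "pmap (tact \<gamma>) (loop_of \<G> \<tau> (g \<cdot> h)) a1 = Some b2"
      using act.compose[of "loop_of \<G> \<tau> g" "loop_of \<G> \<tau> h" a1 a2 b2] 1(2) 2(2) g h gh
      by (simp add: loop_mul)
    show ?thesis
    proof (cases "g \<cdot> h \<in> objs \<G>")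
      case True
      then have "src \<G> h = tgt \<G> g" using mul[OF g h gh] objsD by metis
      moreover have "a1 = b2" using 3 loop_obj[OF True] by (simp add: pmap_x)
      ultimately have "c = a" using 1 2 by simp
      moreover have "a \<in> tset \<gamma> (src \<G> h)" using ranI[of "tmap \<gamma> (src \<G> h)", OF 1(1)] ran_ideal[of "src \<G> h"] h
        unfolding ideal_of_def by blast
      moreover have "src \<G> h = g \<cdot> h" using mul[OF g h gh] objsD True by metis
      ultimately show ?thesis using Gmap_obj[OF True] by simp
    next
      case False
      then show ?thesis using Gmap_eq_Some[of "g \<cdot> h"] 1 2 3 g h gh by auto
    qed
  qed
qed

lemma Gfun_object: "partial_action \<G> UNIV (fob (Gfun \<G> \<tau>) \<gamma>)"
proof -
  have "Gmap \<G> \<tau> \<gamma> g \<circ>\<^sub>m Gmap \<G> \<tau> \<gamma> h \<subseteq>\<^sub>m Gmap \<G> \<tau> \<gamma> (g \<cdot> h)"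
    if "g \<in> arr \<G>" "h \<in> arr \<G>" "src \<G> g = tgt \<G> h" for g h
    using Gmap_compose that by (auto simp: map_le_Some_iff map_comp_Some_iff)
  then show ?thesis unfolding partial_action_def
    using Gmap_iso ran_Gmap_ideal tset_ideal by (auto simp: Gfun_def Gmap_obj)
qed

end

context transversal_loc begin

lemma Ffun_object:
  fixes \<alpha> :: "('g, 'a::ring) paction"
  assumes \<alpha>: "partial_action \<G> UNIV \<alpha>"
  shows "transversal_data \<G> x \<tau> (fob (Ffun \<G> x \<tau>) \<alpha>)"
proof -
  interpret A: partial_action_loc \<G> UNIV \<alpha> using \<alpha> by unfold_locales
  have x': "x \<in> arrows_from_to \<G> x x" by (simp add: arrows_from_to_def)
  have iso: "h \<in> arrows_from_to \<G> x x \<Longrightarrow> h \<in> arr \<G> \<and> src \<G> h = x \<and> tgt \<G> h = x \<and>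
     ginv \<G> h \<in> arrows_from_to \<G> x x" for h by (simp add: arrows_from_to_def)
  have dom: "dom (pmap \<alpha> (\<tau> y)) = pset \<alpha> (ginv \<G> (\<tau> y))"
    and ran: "ran (pmap \<alpha> (\<tau> y)) = pset \<alpha> (\<tau> y)" if "y \<in> objs \<G>" for y
    using that by (simp_all add: A.dom_map A.ran_map)
  have act: "partial_group_action \<G> x (pset \<alpha> x) (tact (fob (Ffun \<G> x \<tau>) \<alpha>))"
    unfolding partial_group_action_def partial_action_def objs_isotropy[OF x]
  proof (intro conjI ballI impI)
    fix h assume h: "h \<in> arr (isotropy \<G> x)"
    note i = iso[of h] A.g_ideal[of h] A.iso[of h] A.obj_ideal[of x, THEN ideal_of_refl]
    show "ideal_of (pset (tact (fob (Ffun \<G> x \<tau>) \<alpha>)) (tgt (isotropy \<G> x) h)) (pset \<alpha> x)"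
      using h i x' by (simp add: Ffun_def)
    show "ideal_of (pset (tact (fob (Ffun \<G> x \<tau>) \<alpha>)) h)
          (pset (tact (fob (Ffun \<G> x \<tau>) \<alpha>)) (tgt (isotropy \<G> x) h))"
      using h i x' by (simp add: Ffun_def)
    show "ring_isom (pmap (tact (fob (Ffun \<G> x \<tau>) \<alpha>)) h)
          (pset (tact (fob (Ffun \<G> x \<tau>) \<alpha>)) (ginv (isotropy \<G> x) h))
          (pset (tact (fob (Ffun \<G> x \<tau>) \<alpha>)) h)"
      using h i x' by (simp add: Ffun_def)
    fix g assume g: "g \<in> arr (isotropy \<G> x)"
    have "h \<cdot> g \<in> arrows_from_to \<G> x x" using h g by (simp add: arrows_from_to_def)
    moreover have "pmap \<alpha> h \<circ>\<^sub>m pmap \<alpha> g \<subseteq>\<^sub>m pmap \<alpha> (h \<cdot> g)"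
      using \<alpha> h g by (simp add: partial_action_def arrows_from_to_def)
    ultimately show "pmap (tact (fob (Ffun \<G> x \<tau>) \<alpha>)) h \<circ>\<^sub>m pmap (tact (fob (Ffun \<G> x \<tau>) \<alpha>)) g
           \<subseteq>\<^sub>m pmap (tact (fob (Ffun \<G> x \<tau>) \<alpha>)) (h \<cdot>\<^bsub>isotropy \<G> x\<^esub> g)"
      using h g by (simp add: Ffun_def)
  qed (use x' in \<open>auto simp: Ffun_def A.map_obj\<close>)
  have f: "ideal_of
          (ran (pmap \<alpha> (\<tau> (tgt \<G> g)) |`
             (pset \<alpha> (ginv \<G> (\<tau> (tgt \<G> g))) \<inter>
              ran (pmap \<alpha> (loop_of \<G> \<tau> g) |`
                (pset \<alpha> (ginv \<G> (\<tau> (src \<G> g))) \<inter> pset \<alpha> (ginv \<G> (loop_of \<G> \<tau> g)))))))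
          (pset \<alpha> (tgt \<G> g))" (is "ideal_of ?X _") if g: "g \<in> arr \<G>" for g
  proof -
    let ?l = "loop_of \<G> \<tau> g" and ?t = "\<tau> (tgt \<G> g)" and ?s = "ginv \<G> (\<tau> (src \<G> g))"
    have "?X = ran (pmap \<alpha> ?t |` (pset \<alpha> (ginv \<G> ?t) \<inter> (pset \<alpha> ?l \<inter> pset \<alpha> (?l \<cdot> ?s))))"
      using A.image[of ?l ?s] g by (simp add: Int_commute)
    also have "\<dots> = ran (pmap \<alpha> ?t |` (pset \<alpha> (ginv \<G> ?t) \<inter> pset \<alpha> ?l)) \<inter>
                     ran (pmap \<alpha> ?t |` (pset \<alpha> (ginv \<G> ?t) \<inter> pset \<alpha> (?l \<cdot> ?s)))"
    proof -
      have "a = b" if "pmap \<alpha> ?t a = Some c" "pmap \<alpha> ?t b = Some c" for a b c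
        using inj_onD_map[OF A.inj_map that] g by simp
      then show ?thesis unfolding set_eq_iff ran_restrict_iff Int_iff Bex_def by metis
    qed
    also have "\<dots> = (pset \<alpha> ?t \<inter> pset \<alpha> (?t \<cdot> ?l)) \<inter> (pset \<alpha> ?t \<inter> pset \<alpha> g)"
      using A.image[of ?t ?l] A.image[of ?t "?l \<cdot> ?s"] g by (simp add: tau_loop_ginv)
    finally show ?thesis
      using A.g_ideal[of ?t] A.g_ideal[of "?t \<cdot> ?l"] A.g_ideal[of g] g by (simp add: ideal_of_Int)
  qed
  have "ring_isom (pmap \<alpha> (\<tau> y)) (dom (pmap \<alpha> (\<tau> y))) (ran (pmap \<alpha> (\<tau> y)))"
    "ideal_of (pset \<alpha> (\<tau> y)) (pset \<alpha> y)" "ideal_of (pset \<alpha> (ginv \<G> (\<tau> y))) (pset \<alpha> x)"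
    if "y \<in> objs \<G>" for y
    using that A.iso[of "\<tau> y"] A.g_ideal[of "\<tau> y"] A.g_ideal[of "ginv \<G> (\<tau> y)"] by (simp_all add: dom ran)
  moreover have "ginv \<G> (loop_of \<G> \<tau> g) \<in> arrows_from_to \<G> x x" if "g \<in> arr \<G>" for g
    using iso that by simp
  ultimately show ?thesis
    using act f A.obj_ideal x' by (auto simp: transversal_data_def Ffun_def dom ran A.map_obj)
qed

lemma par_morphism_restrict:
  "par_morphism \<G> \<alpha> \<alpha>' \<psi> \<Longrightarrow> (\<lambda>y\<in>objs \<G>. \<psi> y) = \<psi>"
  by (auto simp: par_morphism_def extensional_restrict)

lemma tdata_morphism_restrict:
  "tdata_morphism \<G> x \<gamma> \<gamma>' f \<Longrightarrow> (\<lambda>y\<in>objs \<G>. f y) = f"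
  by (auto simp: tdata_morphism_def extensional_restrict)

lemma Ffun_morphism:
  fixes \<alpha> \<alpha>' :: "('g, 'a::ring) paction"
  assumes \<alpha>: "partial_action \<G> UNIV \<alpha>" and \<alpha>': "partial_action \<G> UNIV \<alpha>'"
    and m: "par_morphism \<G> \<alpha> \<alpha>' \<psi>"
  shows "tdata_morphism \<G> x (fob (Ffun \<G> x \<tau>) \<alpha>) (fob (Ffun \<G> x \<tau>) \<alpha>') \<psi>"
proof -
  interpret A: partial_action_loc \<G> UNIV \<alpha> using \<alpha> by unfold_locales
  interpret A': partial_action_loc \<G> UNIV \<alpha>' using \<alpha>' by unfold_locales
  have *: "ran (\<psi> (tgt \<G> g) |` pset \<alpha> g) \<subseteq> pset \<alpha>' g"
    "\<And>a. a \<in> pset \<alpha> (ginv \<G> g) \<Longrightarrow> (pmap \<alpha>' g \<circ>\<^sub>m \<psi> (src \<G> g)) a = (\<psi> (tgt \<G> g) \<circ>\<^sub>m pmap \<alpha> g) a"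
    if "g \<in> arr \<G>" for g
    using m that by (auto simp: par_morphism_def)
  have iso: "h \<in> arrows_from_to \<G> x x \<Longrightarrow> h \<in> arr \<G> \<and> src \<G> h = x \<and> tgt \<G> h = x \<and>
     ginv \<G> h \<in> arrows_from_to \<G> x x" for h by (simp add: arrows_from_to_def)
  have t: "ran (\<psi> y |` pset \<alpha> (\<tau> y)) \<subseteq> pset \<alpha>' (\<tau> y)"
    "ran (\<psi> x |` pset \<alpha> (ginv \<G> (\<tau> y))) \<subseteq> pset \<alpha>' (ginv \<G> (\<tau> y))"
    "\<And>a. a \<in> pset \<alpha> (ginv \<G> (\<tau> y)) \<Longrightarrow>
       (pmap \<alpha>' (\<tau> y) \<circ>\<^sub>m \<psi> x) a = (\<psi> y \<circ>\<^sub>m pmap \<alpha> (\<tau> y)) a"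
    if "y \<in> objs \<G>" for y
    using *(1)[of "\<tau> y"] *(1)[of "ginv \<G> (\<tau> y)"] *(2)[of "\<tau> y"] that by simp_all
  have l: "ran (\<psi> x |` pset \<alpha> h) \<subseteq> pset \<alpha>' h"
    "\<And>a. a \<in> pset \<alpha> (ginv \<G> h) \<Longrightarrow> (pmap \<alpha>' h \<circ>\<^sub>m \<psi> x) a = (\<psi> x \<circ>\<^sub>m pmap \<alpha> h) a"
    if "h \<in> arrows_from_to \<G> x x" for h
    using *[of h] iso[OF that] by simp_all
  have "\<psi> \<in> extensional (objs \<G>)"
    "\<And>y. y \<in> objs \<G> \<Longrightarrow> ring_homom (\<psi> y) (pset \<alpha> y) (pset \<alpha>' y)"
    using m by (auto simp: par_morphism_def)
  then show ?thesis unfolding tdata_morphism_def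
    using t l iso by (simp add: Ffun_def A.dom_map A.ran_map A'.dom_map A'.ran_map)
qed

lemma Gfun_morphism:
  fixes \<gamma> \<gamma>' :: "('g, 'a::ring) tdata"
  assumes \<gamma>: "transversal_data \<G> x \<tau> \<gamma>" and \<gamma>': "transversal_data \<G> x \<tau> \<gamma>'"
    and f: "tdata_morphism \<G> x \<gamma> \<gamma>' f"
  shows "par_morphism \<G> (fob (Gfun \<G> \<tau>) \<gamma>) (fob (Gfun \<G> \<tau>) \<gamma>') f"
proof -
  interpret T: tdata_loc \<G> x \<tau> \<gamma> using \<gamma> by unfold_locales
  interpret T': tdata_loc \<G> x \<tau> \<gamma>' using \<gamma>' by unfold_locales
  have hom: "ring_homom (f y) (tset \<gamma> y) (tset \<gamma>' y)" if "y \<in> objs \<G>" for y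
    using f that by (auto simp: tdata_morphism_def)
  have dm: "\<exists>b\<in>tset \<gamma>' y. f y a = Some b" if "y \<in> objs \<G>" "a \<in> tset \<gamma> y" for y a
    using ring_homomD(2)[OF T.tset_ideal[THEN ideal_of_closed] hom] that by blast
  have key: "\<exists>a' d'. f (src \<G> g) a = Some a' \<and> f (tgt \<G> g) d = Some d' \<and> Gmap \<G> \<tau> \<gamma>' g a' = Some d'"
    if g: "g \<in> arr \<G>" and a: "Gmap \<G> \<tau> \<gamma> g a = Some d" for g a d
  proof (cases "g \<in> objs \<G>")
    case True
    then show ?thesis using a dm by (fastforce simp: T.Gmap_obj T'.Gmap_obj)
  next
    case False
    obtain b c where 1: "tmap \<gamma> (src \<G> g) b = Some a" "pmap (tact \<gamma>) (loop_of \<G> \<tau> g) b = Some c"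
       "tmap \<gamma> (tgt \<G> g) c = Some d" using a T.Gmap_eq_Some[OF g False] by blast
    have tm: "\<exists>b' a'. f x b = Some b' \<and> f y a = Some a' \<and> tmap \<gamma>' y b' = Some a'"
      if y: "y \<in> objs \<G>" and e: "tmap \<gamma> y b = Some a" for y a b
    proof -
      have d: "b \<in> dom (tmap \<gamma> y)" using e by auto
      then have "b \<in> tset \<gamma> x" using T.dom_ideal[OF y] by (auto simp: ideal_of_def)
      then obtain b' where b': "f x b = Some b'" using dm[OF x] by blast
      have "ran (f x |` dom (tmap \<gamma> y)) \<subseteq> dom (tmap \<gamma>' y)"
        and c: "(tmap \<gamma>' y \<circ>\<^sub>m f x) b = (f y \<circ>\<^sub>m tmap \<gamma> y) b"
        using f y d unfolding tdata_morphism_def by blast+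
      then have "b' \<in> dom (tmap \<gamma>' y)" using b' d by (auto simp: subset_iff ran_restrict_iff)
      then obtain a' where a': "tmap \<gamma>' y b' = Some a'" by blast
      have "Some a' = f y a" using c b' e a' by simp
      then show ?thesis using a' b' by metis
    qed
    have am: "\<exists>b' a'. f x b = Some b' \<and> f x a = Some a' \<and> pmap (tact \<gamma>') h b' = Some a'"
      if h: "h \<in> arrows_from_to \<G> x x" and e: "pmap (tact \<gamma>) h b = Some a" for h a b
    proof -
      have h': "ginv \<G> h \<in> arrows_from_to \<G> x x" using h by (simp add: arrows_from_to_def)
      have d: "b \<in> pset (tact \<gamma>) (ginv \<G> h)" using T.act.in_dom[of h] h e by simp
      then have "b \<in> tset \<gamma> x" using T.act.subset_tgt[of "ginv \<G> h"] h' T.act_x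
        by (auto simp: arrows_from_to_def)
      then obtain b' where b': "f x b = Some b'" using dm[OF x] by blast
      have "ran (f x |` pset (tact \<gamma>) (ginv \<G> h)) \<subseteq> pset (tact \<gamma>') (ginv \<G> h)"
        and c: "(pmap (tact \<gamma>') h \<circ>\<^sub>m f x) b = (f x \<circ>\<^sub>m pmap (tact \<gamma>) h) b"
        using f h h' d unfolding tdata_morphism_def by blast+
      then have "b' \<in> pset (tact \<gamma>') (ginv \<G> h)" using b' d by (auto simp: subset_iff ran_restrict_iff)
      then have "\<exists>a'. pmap (tact \<gamma>') h b' = Some a'" using T'.act.domE[of h] h by simp
      then obtain a' where a': "pmap (tact \<gamma>') h b' = Some a'" by blast
      have "Some a' = f x a" using c b' e a' by simp
      then show ?thesis using a' b' by metis
    qed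
    show ?thesis using tm[OF _ 1(1)] am[OF _ 1(2)] tm[OF _ 1(3)] g False
      by (fastforce simp: T'.Gmap_eq_Some)
  qed
  have sub: "ran (f (tgt \<G> g) |` ran (Gmap \<G> \<tau> \<gamma> g)) \<subseteq> ran (Gmap \<G> \<tau> \<gamma>' g)" if "g \<in> arr \<G>" for g
  proof
    fix c assume "c \<in> ran (f (tgt \<G> g) |` ran (Gmap \<G> \<tau> \<gamma> g))"
    then obtain d where d: "d \<in> ran (Gmap \<G> \<tau> \<gamma> g)" "f (tgt \<G> g) d = Some c"
      unfolding ran_restrict_iff by blast
    then obtain a where "Gmap \<G> \<tau> \<gamma> g a = Some d" unfolding ran_iff by blast
    note this d(2)
    then show "c \<in> ran (Gmap \<G> \<tau> \<gamma>' g)" using key[OF that] by (metis option.sel ranI)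
  qed
  have comm: "(Gmap \<G> \<tau> \<gamma>' g \<circ>\<^sub>m f (src \<G> g)) a = (f (tgt \<G> g) \<circ>\<^sub>m Gmap \<G> \<tau> \<gamma> g) a"
    if g: "g \<in> arr \<G>" and a: "a \<in> ran (Gmap \<G> \<tau> \<gamma> (ginv \<G> g))" for g a
  proof -
    obtain d where "Gmap \<G> \<tau> \<gamma> g a = Some d" using T.dom_Gmap[OF g] a by blast
    then show ?thesis using key[OF g] by fastforce
  qed
  show ?thesis
    using f sub comm hom
    by (simp add: par_morphism_def Gfun_def T.Gmap_obj T'.Gmap_obj tdata_morphism_def)
qed

lemma family_comp_restrict:
  "(\<lambda>y\<in>Y. family_comp Y g f y) = family_comp Y (\<lambda>y\<in>Y. g y) (\<lambda>y\<in>Y. f y)"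
  by (rule ext) (simp add: family_comp_def)

lemma tdata_morphism_comp:
  fixes \<gamma> \<gamma>' \<gamma>'' :: "('g, 'a::ring) tdata"
  assumes \<gamma>: "transversal_data \<G> x \<tau> \<gamma>" and \<gamma>': "transversal_data \<G> x \<tau> \<gamma>'"
    and f: "tdata_morphism \<G> x \<gamma> \<gamma>' f" and f': "tdata_morphism \<G> x \<gamma>' \<gamma>'' f'"
  shows "tdata_morphism \<G> x \<gamma> \<gamma>'' (family_comp (objs \<G>) f' f)"
proof -
  interpret T: tdata_loc \<G> x \<tau> \<gamma> using \<gamma> by unfold_locales
  interpret T': tdata_loc \<G> x \<tau> \<gamma>' using \<gamma>' by unfold_locales
  have dm: "\<exists>b. f x a = Some b" if "a \<in> tset \<gamma> x" for a
    using f that x unfolding tdata_morphism_def ring_homom_def by blast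
  have hom: "ring_homom (f' y \<circ>\<^sub>m f y) (tset \<gamma> y) (tset \<gamma>'' y)" if "y \<in> objs \<G>" for y
    by (rule ring_homom_comp[of _ "tset \<gamma>' y"])
      (use f f' that T.tset_ideal[THEN ideal_of_closed] T'.tset_ideal[THEN ideal_of_closed]
       in \<open>auto simp: tdata_morphism_def\<close>)
  have sub: "ran ((u' \<circ>\<^sub>m u) |` S) \<subseteq> S''" if "ran (u |` S) \<subseteq> S'" "ran (u' |` S') \<subseteq> S''"
    for u u' :: "'a \<rightharpoonup> 'a" and S S' S''
    using that unfolding subset_iff ran_restrict_iff by (fastforce simp: map_comp_Some_iff)
  have comm: "(p'' \<circ>\<^sub>m (u' \<circ>\<^sub>m u)) a = (v' \<circ>\<^sub>m v \<circ>\<^sub>m p) a"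
    if "a \<in> tset \<gamma> x" "u = f x" "ran (u |` S) \<subseteq> S'" "\<forall>a\<in>S. (p' \<circ>\<^sub>m u) a = (v \<circ>\<^sub>m p) a"
      "\<forall>a\<in>S'. (p'' \<circ>\<^sub>m u') a = (v' \<circ>\<^sub>m p') a" "a \<in> S"
    for p p' p'' u u' v v' :: "'a \<rightharpoonup> 'a" and S S' a
  proof -
    have "\<exists>b. u a = Some b" using dm that by blast
    then obtain b where b: "u a = Some b" by blast
    then have "b \<in> S'" using that by (auto simp: subset_iff ran_restrict_iff)
    then have "(p'' \<circ>\<^sub>m (u' \<circ>\<^sub>m u)) a = (v' \<circ>\<^sub>m (p' \<circ>\<^sub>m u)) a" using that b by (simp add: map_comp_def)
    also have "\<dots> = (v' \<circ>\<^sub>m (v \<circ>\<^sub>m p)) a" using that by (simp add: map_comp_def)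
    finally show ?thesis by (simp add: map_comp_assoc)
  qed
  have y: "ran ((f' y \<circ>\<^sub>m f y) |` ran (tmap \<gamma> y)) \<subseteq> ran (tmap \<gamma>'' y)" if "y \<in> objs \<G>" "y \<noteq> x" for y
    by (rule sub[of "f y" _ "ran (tmap \<gamma>' y)"]) (use f f' that in \<open>simp_all add: tdata_morphism_def\<close>)
  have y': "ran ((f' x \<circ>\<^sub>m f x) |` dom (tmap \<gamma> y)) \<subseteq> dom (tmap \<gamma>'' y)" if "y \<in> objs \<G>" for y
    by (rule sub[of "f x" _ "dom (tmap \<gamma>' y)"]) (use f f' that in \<open>simp_all add: tdata_morphism_def\<close>)
  have yc: "(tmap \<gamma>'' y \<circ>\<^sub>m (f' x \<circ>\<^sub>m f x)) a = (f' y \<circ>\<^sub>m f y \<circ>\<^sub>m tmap \<gamma> y) a"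
    if "y \<in> objs \<G>" "a \<in> dom (tmap \<gamma> y)" for y a
  proof (rule comm)
    show "a \<in> tset \<gamma> x" using T.dom_ideal[of y] that unfolding ideal_of_def by blast
    show "ran (f x |` dom (tmap \<gamma> y)) \<subseteq> dom (tmap \<gamma>' y)"
      "\<forall>a\<in>dom (tmap \<gamma> y). (tmap \<gamma>' y \<circ>\<^sub>m f x) a = (f y \<circ>\<^sub>m tmap \<gamma> y) a"
      "\<forall>a\<in>dom (tmap \<gamma>' y). (tmap \<gamma>'' y \<circ>\<^sub>m f' x) a = (f' y \<circ>\<^sub>m tmap \<gamma>' y) a"
      using f f' that unfolding tdata_morphism_def by blast+
  qed (use that in auto)
  have h: "ran ((f' x \<circ>\<^sub>m f x) |` pset (tact \<gamma>) h) \<subseteq> pset (tact \<gamma>'') h"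
    if "h \<in> arrows_from_to \<G> x x" for h
    by (rule sub[of "f x" _ "pset (tact \<gamma>') h"]) (use f f' that in \<open>simp_all add: tdata_morphism_def\<close>)
  have hc: "(pmap (tact \<gamma>'') h \<circ>\<^sub>m (f' x \<circ>\<^sub>m f x)) a = (f' x \<circ>\<^sub>m f x \<circ>\<^sub>m pmap (tact \<gamma>) h) a"
    if h: "h \<in> arrows_from_to \<G> x x" and a: "a \<in> pset (tact \<gamma>) (ginv \<G> h)" for h a
  proof (rule comm)
    have h': "ginv \<G> h \<in> arrows_from_to \<G> x x" using h by (simp add: arrows_from_to_def)
    then show "a \<in> tset \<gamma> x" using a T.act.subset_tgt[of "ginv \<G> h"] T.act_x
      by (auto simp: arrows_from_to_def)
    show "ran (f x |` pset (tact \<gamma>) (ginv \<G> h)) \<subseteq> pset (tact \<gamma>') (ginv \<G> h)"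
      "\<forall>a\<in>pset (tact \<gamma>) (ginv \<G> h). (pmap (tact \<gamma>') h \<circ>\<^sub>m f x) a = (f x \<circ>\<^sub>m pmap (tact \<gamma>) h) a"
      "\<forall>a\<in>pset (tact \<gamma>') (ginv \<G> h). (pmap (tact \<gamma>'') h \<circ>\<^sub>m f' x) a = (f' x \<circ>\<^sub>m pmap (tact \<gamma>') h) a"
      using f f' h h' unfolding tdata_morphism_def by blast+
  qed (use a in auto)
  show ?thesis unfolding tdata_morphism_def family_comp_def
    using hom y y' yc h hc by simp
qed

lemma tdata_morphism_id:
  fixes \<gamma> :: "('g, 'a::ring) tdata"
  assumes \<gamma>: "transversal_data \<G> x \<tau> \<gamma>"
  shows "tdata_morphism \<G> x \<gamma> \<gamma> (\<lambda>y\<in>objs \<G>. pid (tset \<gamma> y))"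
proof -
  interpret T: tdata_loc \<G> x \<tau> \<gamma> using \<gamma> by unfold_locales
  have id: "pid S a = Some a" if "a \<in> S" for S :: "'a set" and a using that by simp
  have t: "dom (tmap \<gamma> y) \<subseteq> tset \<gamma> x" "ran (tmap \<gamma> y) \<subseteq> tset \<gamma> y" if "y \<in> objs \<G>" for y
    using T.dom_ideal T.ran_ideal that by (auto simp: ideal_of_def)
  have a: "pset (tact \<gamma>) h \<subseteq> tset \<gamma> x" "ran (pmap (tact \<gamma>) h) \<subseteq> tset \<gamma> x"
    if "h \<in> arrows_from_to \<G> x x" for h
    using T.act.subset_tgt[of h] T.act.ran_map[of h] T.act_x that by (auto simp: arrows_from_to_def)
  have a': "pset (tact \<gamma>) (ginv \<G> h) \<subseteq> tset \<gamma> x" if "h \<in> arrows_from_to \<G> x x" for h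
    using a(1)[of "ginv \<G> h"] that by (simp add: arrows_from_to_def)
  show ?thesis unfolding tdata_morphism_def
    using t a a' T.tset_ideal[THEN ideal_of_closed]
    by (auto simp: ring_homom_pid ran_restrict_iff pid_comp map_comp_def[of _ "pid _"] id subset_iff)
qed

theorem Dcat_category: "is_category (Dcat \<G> x \<tau> :: (('g, 'a::ring) tdata, ('g, 'a) family) cat)"
  unfolding is_category_def Dcat_def
  apply (auto simp: tdata_morphism_comp tdata_morphism_id family_comp_assoc)
  by (rule family_comp_pid; auto simp: tdata_morphism_def)+

theorem Ffun_functor:
  "is_functor (Gpar \<G> :: (('g, 'a::ring) paction, ('g, 'a) family) cat) (Dcat \<G> x \<tau>) (Ffun \<G> x \<tau>)"
proof (rule is_functorI)
  show "fob (Ffun \<G> x \<tau>) \<alpha> \<in> Ob (Dcat \<G> x \<tau>)" if "\<alpha> \<in> Ob (Gpar \<G>)" for \<alpha> :: "('g, 'a) paction"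
    using that Ffun_object by (simp add: Gpar_def Dcat_def)
  show "fmor (Ffun \<G> x \<tau>) (Ident (Gpar \<G>) \<alpha>) = Ident (Dcat \<G> x \<tau>) (fob (Ffun \<G> x \<tau>) \<alpha>)"
    for \<alpha> :: "('g, 'a) paction"
    by (rule ext) (simp add: Gpar_def Dcat_def Ffun_def)
  show "fmor (Ffun \<G> x \<tau>) \<psi> \<in> Hom (Dcat \<G> x \<tau>) (fob (Ffun \<G> x \<tau>) \<alpha>) (fob (Ffun \<G> x \<tau>) \<alpha>')"
    if a: "\<alpha> \<in> Ob (Gpar \<G>)" "\<alpha>' \<in> Ob (Gpar \<G>)" "\<psi> \<in> Hom (Gpar \<G>) \<alpha> \<alpha>'"
    for \<alpha> \<alpha>' :: "('g, 'a) paction" and \<psi>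
  proof -
    have m: "par_morphism \<G> \<alpha> \<alpha>' \<psi>" using a by (simp add: Gpar_def)
    have "fmor (Ffun \<G> x \<tau>) \<psi> = \<psi>" unfolding Ffun_def using par_morphism_restrict[OF m] by simp
    then show ?thesis using Ffun_morphism a m by (simp add: Gpar_def Dcat_def)
  qed
qed (simp add: Gpar_def Dcat_def Ffun_def family_comp_restrict[unfolded restrict_def] restrict_def)

theorem Gfun_functor:
  "is_functor (Dcat \<G> x \<tau> :: (('g, 'a::ring) tdata, ('g, 'a) family) cat) (Gpar \<G>) (Gfun \<G> \<tau>)"
proof (rule is_functorI)
  show "fob (Gfun \<G> \<tau>) \<gamma> \<in> Ob (Gpar \<G>)" if "\<gamma> \<in> Ob (Dcat \<G> x \<tau>)" for \<gamma> :: "('g, 'a) tdata"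
    using that tdata_loc.Gfun_object[OF tdata_loc.intro, OF transversal_loc_axioms]
    by (simp add: Gpar_def Dcat_def tdata_loc_axioms_def)
  show "fmor (Gfun \<G> \<tau>) (Ident (Dcat \<G> x \<tau>) \<gamma>) = Ident (Gpar \<G>) (fob (Gfun \<G> \<tau>) \<gamma>)"
    for \<gamma> :: "('g, 'a) tdata"
    by (rule ext) (simp add: Gpar_def Dcat_def Gfun_def Gmap_def)
  show "fmor (Gfun \<G> \<tau>) f \<in> Hom (Gpar \<G>) (fob (Gfun \<G> \<tau>) \<gamma>) (fob (Gfun \<G> \<tau>) \<gamma>')"
    if a: "\<gamma> \<in> Ob (Dcat \<G> x \<tau>)" "\<gamma>' \<in> Ob (Dcat \<G> x \<tau>)" "f \<in> Hom (Dcat \<G> x \<tau>) \<gamma> \<gamma>'"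
    for \<gamma> \<gamma>' :: "('g, 'a) tdata" and f
  proof -
    have m: "tdata_morphism \<G> x \<gamma> \<gamma>' f" using a by (simp add: Dcat_def)
    have "fmor (Gfun \<G> \<tau>) f = f" unfolding Gfun_def using tdata_morphism_restrict[OF m] by simp
    then show ?thesis using Gfun_morphism a m by (simp add: Gpar_def Dcat_def)
  qed
qed (simp add: Gpar_def Dcat_def Gfun_def family_comp_restrict[unfolded restrict_def] restrict_def)

end

end

theory Submission
  imports Defs
begin

text \<open>
  The ring isomorphism \<open>\<beta>\<^sub>g\<close> is the restriction of \<open>\<alpha>\<^sub>g\<close> to those \<open>a\<close> for which
  the factorisation \<open>g = \<tau>\<^sub>t \<cdot> g\<^sub>x \<cdot> \<tau>\<^sub>s\<inverse>\<close> can be followed step by step.  Read backwards from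
  the value \<open>d\<close> of \<open>\<alpha>\<^sub>g\<close> at \<open>a\<close>, this says that \<open>d\<close> lies in \<open>A\<^sub>h\<close> for \<open>h = \<tau>\<^sub>t\<close> and for
  \<open>h = g \<cdot> \<tau>\<^sub>s = \<tau>\<^sub>t \<cdot> g\<^sub>x\<close>.  For (ii), the loop of \<open>\<tau> y\<close> is \<open>x\<close> and the loop of an arrow of the
  isotropy group is the arrow itself, so two of the three factors are identities.
\<close>

lemma map_eqI: "(\<And>a b. u a = Some b \<longleftrightarrow> v a = Some b) \<Longrightarrow> u = v"
  by (simp add: map_le_antisym map_le_Some_iff)

context transversal_loc begin

text \<open>Both claims of (i) come from this: the first conjunct yields the inequality, and the
  membership of \<open>d\<close> is the only obstruction to equality. At an object \<open>y\<close>
  the three-step composite would be the identity of only \<open>pset \<alpha> (\<tau> y)\<close>, so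
  identities stay outside this formula.\<close>

lemma Gmap_Ffun_eq_Some:
  fixes \<alpha> :: "('g, 'a::ring) paction"
  assumes \<alpha>: "partial_action \<G> UNIV \<alpha>" and g: "g \<in> arr \<G>" "g \<notin> objs \<G>"
  shows "Gmap \<G> \<tau> (fob (Ffun \<G> x \<tau>) \<alpha>) g a = Some d \<longleftrightarrow>
    pmap \<alpha> g a = Some d \<and> d \<in> pset \<alpha> (\<tau> (tgt \<G> g)) \<inter> pset \<alpha> (g \<cdot> \<tau> (src \<G> g))"
proof -
  interpret A: partial_action_loc \<G> UNIV \<alpha> using \<alpha> by unfold_locales
  interpret T: tdata_loc \<G> x \<tau> "fob (Ffun \<G> x \<tau>) \<alpha>"
    using Ffun_object[OF \<alpha>] by unfold_locales
  let ?l = "loop_of \<G> \<tau> g" and ?t = "\<tau> (tgt \<G> g)" and ?s = "\<tau> (src \<G> g)"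
  have "Gmap \<G> \<tau> (fob (Ffun \<G> x \<tau>) \<alpha>) g a = Some d \<longleftrightarrow>
      (\<exists>b c. pmap \<alpha> ?s b = Some a \<and> pmap \<alpha> ?l b = Some c \<and> pmap \<alpha> ?t c = Some d)"
    using g by (subst T.Gmap_eq_Some) (simp_all add: Ffun_def)
  also have "\<dots> \<longleftrightarrow> pmap \<alpha> g a = Some d \<and> d \<in> pset \<alpha> ?t \<inter> pset \<alpha> (g \<cdot> ?s)" (is "?L \<longleftrightarrow> ?R")
  proof
    assume ?L
    then obtain b c
      where bc: "pmap \<alpha> ?s b = Some a" "pmap \<alpha> ?l b = Some c" "pmap \<alpha> ?t c = Some d" by blast
    \<comment> \<open>The last two steps compose along \<open>?t \<cdot> ?l = g \<cdot> ?s\<close>;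
      undoing the first step then cancels \<open>?s\<close> and leaves \<open>g\<close>.\<close>
    have bd: "pmap \<alpha> (g \<cdot> ?s) b = Some d"
      using A.compose[OF _ _ _ bc(2,3)] g by (simp add: tau_loop)
    have ab: "pmap \<alpha> (ginv \<G> ?s) a = Some b" using bc(1) g by (simp add: A.map_ginv)
    have "pmap \<alpha> (g \<cdot> ?s \<cdot> ginv \<G> ?s) a = Some d"
      using A.compose[OF _ _ _ ab bd] g by simp
    then have "pmap \<alpha> g a = Some d" using g unit(1)[of g] by (simp add: assoc)
    then show ?R using A.in_ran[OF _ bc(3)] A.in_ran[OF _ bd] g by simp
  next
    assume R: ?R
    then have ad: "pmap \<alpha> g a = Some d" by blast
    \<comment> \<open>Each \<open>pset \<alpha> h\<close> is the range of
      \<open>pmap \<alpha> h\<close>, so the two memberships of \<open>d\<close> supply the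
      intermediate points \<open>c\<close> and \<open>b\<close>.\<close>
    obtain c where c: "pmap \<alpha> ?t c = Some d" using R A.ranE[of ?t d] g by auto
    obtain b where b: "pmap \<alpha> (g \<cdot> ?s) b = Some d" using R A.ranE[of "g \<cdot> ?s" d] g by auto
    have da: "pmap \<alpha> (ginv \<G> g) d = Some a" using ad g by (simp add: A.map_ginv)
    have dc: "pmap \<alpha> (ginv \<G> ?t) d = Some c" using c g by (simp add: A.map_ginv)
    \<comment> \<open>Going from \<open>b\<close> to \<open>d\<close> and back gives the missing
      steps, since \<open>ginv \<G> g \<cdot> (g \<cdot> ?s) = ?s\<close> and
      \<open>ginv \<G> ?t \<cdot> (g \<cdot> ?s) = ?l\<close>.\<close>
    have "pmap \<alpha> ?s b = Some a" using A.compose[OF _ _ _ b da] g by simp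
    moreover have "pmap \<alpha> ?l b = Some c"
      using A.compose[OF _ _ _ b dc] g by (simp add: loop_of_def assoc)
    ultimately show ?L using c by blast
  qed
  finally show ?thesis .
qed

lemma Gmap_Ffun_obj:
  assumes "partial_action \<G> UNIV \<alpha>" "y \<in> objs \<G>"
  shows "Gmap \<G> \<tau> (fob (Ffun \<G> x \<tau>) \<alpha>) y = pmap \<alpha> y"
  using assms by (simp add: Gmap_def Ffun_def partial_action_def)

lemma Gmap_Ffun_le:
  fixes \<alpha> :: "('g, 'a::ring) paction"
  assumes "partial_action \<G> UNIV \<alpha>" "g \<in> arr \<G>"
  shows "Gmap \<G> \<tau> (fob (Ffun \<G> x \<tau>) \<alpha>) g \<subseteq>\<^sub>m pmap \<alpha> g"
  using assms Gmap_Ffun_eq_Some[of \<alpha> g] Gmap_Ffun_obj[of \<alpha> g]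
  by (cases "g \<in> objs \<G>") (auto simp: map_le_Some_iff)

text \<open>Given \<open>Gmap_Ffun_le\<close>, equality only asks that no value of
  \<open>pmap \<alpha> g\<close> be lost, and these values form
  \<open>pset \<alpha> g\<close>.\<close>

lemma Gmap_Ffun_eq_iff:
  fixes \<alpha> :: "('g, 'a::ring) paction"
  assumes \<alpha>: "partial_action \<G> UNIV \<alpha>" and g: "g \<in> arr \<G>" "g \<notin> objs \<G>"
  shows "Gmap \<G> \<tau> (fob (Ffun \<G> x \<tau>) \<alpha>) g = pmap \<alpha> g \<longleftrightarrow>
    pset \<alpha> g \<subseteq> pset \<alpha> (\<tau> (tgt \<G> g)) \<inter> pset \<alpha> (g \<cdot> \<tau> (src \<G> g))"
    (is "?G = _ \<longleftrightarrow> _ \<subseteq> ?S")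
proof -
  interpret A: partial_action_loc \<G> UNIV \<alpha> using \<alpha> by unfold_locales
  have "?G = pmap \<alpha> g \<longleftrightarrow> pmap \<alpha> g \<subseteq>\<^sub>m ?G"
    using Gmap_Ffun_le[OF \<alpha> g(1)] map_le_antisym by force
  also have "\<dots> \<longleftrightarrow> ran (pmap \<alpha> g) \<subseteq> ?S"
    unfolding map_le_Some_iff Gmap_Ffun_eq_Some[OF assms] by (auto simp: ran_iff subset_iff)
  finally show ?thesis using g by (simp add: A.ran_map)
qed

text \<open>The maps decide the ideals: on either side each ideal is the range of its map, and
  extensionality fixes both families outside the arrows.\<close>

lemma Gfun_Ffun_eq_iff:
  fixes \<alpha> :: "('g, 'a::ring) paction"
  assumes \<alpha>: "partial_action \<G> UNIV \<alpha>"
  shows "fob (Gfun \<G> \<tau>) (fob (Ffun \<G> x \<tau>) \<alpha>) = \<alpha> \<longleftrightarrow>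
    (\<forall>g\<in>arr \<G>. Gmap \<G> \<tau> (fob (Ffun \<G> x \<tau>) \<alpha>) g = pmap \<alpha> g)" (is "?L \<longleftrightarrow> ?R")
proof
  assume ?L
  then have "pmap (fob (Gfun \<G> \<tau>) (fob (Ffun \<G> x \<tau>) \<alpha>)) = pmap \<alpha>" by simp
  then show ?R by (auto simp: Gfun_def fun_eq_iff restrict_def split: if_splits)
next
  assume R: ?R
  interpret A: partial_action_loc \<G> UNIV \<alpha> using \<alpha> by unfold_locales
  have "pset \<alpha> \<in> extensional (arr \<G>)" "pmap \<alpha> \<in> extensional (arr \<G>)"
    using \<alpha> by (auto simp: partial_action_def)
  then have "(\<lambda>g\<in>arr \<G>. ran (Gmap \<G> \<tau> (fob (Ffun \<G> x \<tau>) \<alpha>) g)) = pset \<alpha>"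
    "(\<lambda>g\<in>arr \<G>. Gmap \<G> \<tau> (fob (Ffun \<G> x \<tau>) \<alpha>) g) = pmap \<alpha>"
    using R by (auto simp: A.ran_map intro: extensionalityI)
  then show ?L by (simp add: Gfun_def)
qed

lemma loop_tau: "y \<in> objs \<G> \<Longrightarrow> loop_of \<G> \<tau> (\<tau> y) = x"
  using unit(1)[of x] by (simp add: loop_of_def)

lemma loop_of_isotropy: "h \<in> arrows_from_to \<G> x x \<Longrightarrow> loop_of \<G> \<tau> h = h"
  using unit[of h] by (auto simp: loop_of_def arrows_from_to_def)

end

context tdata_loc begin

text \<open>Only the leftmost factor is nontrivial: the loop \<open>x\<close> acts as the identity
  of \<open>tset \<gamma> x\<close>, and so does the transversal map at the source
  \<open>x\<close>.\<close>

lemma Gmap_tau: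
  assumes y: "y \<in> objs \<G>"
  shows "Gmap \<G> \<tau> \<gamma> (\<tau> y) = tmap \<gamma> y"
proof (cases "\<tau> y \<in> objs \<G>")
  case True
  \<comment> \<open>An object is its own source and target, while \<open>\<tau> y\<close> has source
    \<open>x\<close> and target \<open>y\<close>.\<close>
  then have "y = x" using objsD(2,3)[OF True] tau(2,3)[OF y] by argo
  then show ?thesis by (simp add: Gmap_obj tmap_x)
next
  case False
  \<comment> \<open>This ensures that composing with the identities does not shrink the
    domain.\<close>
  have "a \<in> tset \<gamma> x" if "tmap \<gamma> y a = Some d" for a d
    using dom_ideal[OF y] that by (auto simp: ideal_of_def)
  then have "Gmap \<G> \<tau> \<gamma> (\<tau> y) a = Some d \<longleftrightarrow> tmap \<gamma> y a = Some d" for a d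
    using y False by (auto simp: Gmap_eq_Some loop_tau tmap_x pmap_x)
  then show ?thesis by (rule map_eqI)
qed

lemma Gmap_isotropy:
  assumes h: "h \<in> arrows_from_to \<G> x x"
  shows "Gmap \<G> \<tau> \<gamma> h = pmap (tact \<gamma>) h"
proof (cases "h \<in> objs \<G>")
  case True
  then have "h = x" using h by (auto simp: arrows_from_to_def)
  then show ?thesis by (simp add: Gmap_obj pmap_x)
next
  case False
  have h': "h \<in> arr \<G>" "src \<G> h = x" "tgt \<G> h = x" using h by (auto simp: arrows_from_to_def)
  \<comment> \<open>The identity \<open>tmap \<gamma> x\<close> now stands on both sides, so domain
    and range must both lie in \<open>tset \<gamma> x\<close>.\<close>
  have "a \<in> tset \<gamma> x \<and> d \<in> tset \<gamma> x" if "pmap (tact \<gamma>) h a = Some d" for a d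
    using act.in_dom[OF _ that] act.in_ran[OF _ that] act.subset_tgt[of h]
      act.subset_tgt[of "ginv \<G> h"] act_x h h' by (auto simp: arrows_from_to_def)
  then have "Gmap \<G> \<tau> \<gamma> h a = Some d \<longleftrightarrow> pmap (tact \<gamma>) h a = Some d" for a d
    using h h' False by (auto simp: Gmap_eq_Some loop_of_isotropy tmap_x)
  then show ?thesis by (rule map_eqI)
qed

lemma Ffun_Gfun: "fob (Ffun \<G> x \<tau>) (fob (Gfun \<G> \<tau>) \<gamma>) = \<gamma>"
proof -
  have ext: "tset \<gamma> \<in> extensional (objs \<G>)" "tmap \<gamma> \<in> extensional (objs \<G>)"
    "pset (tact \<gamma>) \<in> extensional (arrows_from_to \<G> x x)"
    "pmap (tact \<gamma>) \<in> extensional (arrows_from_to \<G> x x)"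
    using td act.pa by (auto simp: transversal_data_def partial_action_def)
  have arr: "h \<in> arr \<G>" if "h \<in> arrows_from_to \<G> x x" for h
    using that by (simp add: arrows_from_to_def)
  let ?\<delta> = "fob (Ffun \<G> x \<tau>) (fob (Gfun \<G> \<tau>) \<gamma>)"
  have "tset ?\<delta> = tset \<gamma>"
    by (rule extensionalityI[OF _ ext(1)])
      (simp_all add: Ffun_def Gfun_def Gmap_obj del: restrict_restrict)
  moreover have "tmap ?\<delta> = tmap \<gamma>"
    by (rule extensionalityI[OF _ ext(2)])
      (simp_all add: Ffun_def Gfun_def Gmap_tau del: restrict_restrict)
  \<comment> \<open>\<open>Gfun\<close> takes ranges as its ideals; the given ideal at
    \<open>h\<close> returns because the partial action maps onto it.\<close>
  moreover have "pset (tact ?\<delta>) = pset (tact \<gamma>)"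
    by (rule extensionalityI[OF _ ext(3)])
      (simp_all add: Ffun_def Gfun_def Gmap_isotropy arr act.ran_map del: restrict_restrict)
  moreover have "pmap (tact ?\<delta>) = pmap (tact \<gamma>)"
    by (rule extensionalityI[OF _ ext(4)])
      (simp_all add: Ffun_def Gfun_def Gmap_isotropy arr del: restrict_restrict)
  ultimately show ?thesis by simp
qed

end

theorem proposition3p5:
  fixes \<G> :: "'g groupoid_data" and x :: 'g and \<tau> :: "'g \<Rightarrow> 'g"
    and F :: "(('g, 'a::ring) paction, ('g, 'a) family, ('g, 'a) tdata, ('g, 'a) family) functor_data"
    and G :: "(('g, 'a) tdata, ('g, 'a) family, ('g, 'a) paction, ('g, 'a) family) functor_data"
  assumes "groupoid \<G>" and "connected_groupoid \<G>" and "x \<in> objs \<G>" and "transversal \<G> x \<tau>"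
  defines "F \<equiv> Ffun \<G> x \<tau>" and "G \<equiv> Gfun \<G> \<tau>"
  shows
    "(\<forall>\<alpha>\<in>Ob (Gpar \<G>). \<forall>\<beta>. \<beta> = fob (G \<circ>\<^sub>F F) \<alpha> \<longrightarrow>
        (\<forall>g\<in>arr \<G>. pmap \<beta> g \<subseteq>\<^sub>m pmap \<alpha> g) \<and>
        (\<beta> = \<alpha> \<longleftrightarrow>
           (\<forall>g\<in>arr \<G> - objs \<G>.
              pset \<alpha> g \<subseteq> pset \<alpha> (\<tau> (tgt \<G> g)) \<inter> pset \<alpha> (g \<cdot>\<^bsub>\<G>\<^esub> \<tau> (src \<G> g))))) \<and>
     (\<forall>\<gamma>\<in>Ob (Dcat \<G> x \<tau>). fob (F \<circ>\<^sub>F G) \<gamma> = \<gamma>) \<and>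
     (\<forall>\<gamma>\<in>Ob (Dcat \<G> x \<tau>). \<forall>\<gamma>'\<in>Ob (Dcat \<G> x \<tau>). \<forall>f\<in>Hom (Dcat \<G> x \<tau>) \<gamma> \<gamma>'.
        fmor (F \<circ>\<^sub>F G) f = f)"
proof (intro conjI ballI allI impI)
  interpret transversal_loc \<G> x \<tau> using assms(1,3,4) by unfold_locales
  fix \<alpha> \<beta> :: "('g, 'a) paction"
  assume "\<alpha> \<in> Ob (Gpar \<G>)" and \<beta>: "\<beta> = fob (G \<circ>\<^sub>F F) \<alpha>"
  then have \<alpha>: "partial_action \<G> UNIV \<alpha>" by (simp add: Gpar_def)
  have \<beta>': "\<beta> = fob (Gfun \<G> \<tau>) (fob (Ffun \<G> x \<tau>) \<alpha>)"
    using \<beta> by (simp add: functor_comp_def F_def G_def)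
  show "pmap \<beta> g \<subseteq>\<^sub>m pmap \<alpha> g" if "g \<in> arr \<G>" for g
    using Gmap_Ffun_le[OF \<alpha> that] that by (simp add: \<beta>' Gfun_def)
  show "\<beta> = \<alpha> \<longleftrightarrow>
      (\<forall>g\<in>arr \<G> - objs \<G>.
         pset \<alpha> g \<subseteq> pset \<alpha> (\<tau> (tgt \<G> g)) \<inter> pset \<alpha> (g \<cdot>\<^bsub>\<G>\<^esub> \<tau> (src \<G> g)))"
    \<comment> \<open>At objects both maps are identities, so only the remaining arrows impose a
      condition.\<close>
    unfolding \<beta>' Gfun_Ffun_eq_iff[OF \<alpha>]
    using Gmap_Ffun_eq_iff[OF \<alpha>] Gmap_Ffun_obj[OF \<alpha>] by blast
next
  fix \<gamma> :: "('g, 'a) tdata"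
  assume "\<gamma> \<in> Ob (Dcat \<G> x \<tau>)"
  then interpret tdata_loc \<G> x \<tau> \<gamma>
    using assms(1,3,4) by unfold_locales (simp_all add: Dcat_def)
  show "fob (F \<circ>\<^sub>F G) \<gamma> = \<gamma>"
    using Ffun_Gfun by (simp add: functor_comp_def F_def G_def)
next
  interpret transversal_loc \<G> x \<tau> using assms(1,3,4) by unfold_locales
  fix \<gamma> \<gamma>' :: "('g, 'a) tdata" and f
  assume "f \<in> Hom (Dcat \<G> x \<tau>) \<gamma> \<gamma>'"
  \<comment> \<open>Both functors act on morphisms by restriction to the objects, which leaves an
    extensional family unchanged.\<close>
  then have "(\<lambda>y\<in>objs \<G>. f y) = f"
    by (intro tdata_morphism_restrict) (simp add: Dcat_def)
  then show "fmor (F \<circ>\<^sub>F G) f = f"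
    by (simp add: functor_comp_def F_def G_def Ffun_def Gfun_def)
qed

end
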